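(* Let $N\subseteq M\subseteq P$ be a tower of $II_1$ factors with $[P:N]<\infty$ (or a tower of finite dimensional $C^*$-algebras where the two inclusions $N\subseteq M$ and $M\subseteq P$ are connected, with inclusion matrices $G$ and $H$ respectively). In either case, let $\{\lambda_i : 1\le i\le m\}$ be a basis for $M/N$ and let $\{\mu_j : 1\le j\le n\}$ be a basis for $P/M$. Then $\{\lambda_i\mu_j : 1\le i\le m,\ 1\le j\le n\}$ is a basis for $P/N$.
   Context: All inclusions are unital inclusions of finite von Neumann algebras with a faithful normal tracial state. For an inclusion $A\subseteq B$ with trace $tr$ on $B$, $\langle B,e_A\rangle$ denotes Jones' basic construction, the von Neumann algebra generated on $L^2(B,tr)$ by $B$ and the orthogonal projection $e_A$ onto $L^2(A,tr)$ (the Jones projection). The trace $tr$ on $B$ is a Markov trace of modulus $\tau$ if it extends to a positive trace $Tr$ on $\langle B,e_A\rangle$ with $Tr(xe_A)=\tau\,tr(x)$ for $x\in B$. If $A\subseteq B$ are $II_1$ factors with $[B:A]<\infty$, there is a unique Markov trace on $B$, with modulus $\tau=[B:A]^{-1}$. If $A\subseteq B$ is a connected inclusion of finite dimensional $C^*$-algebras (connected Bratteli diagram) with inclusion matrix $K$, there is a unique Markov trace (normalized) on $B$, with modulus $\tau=\|K\|^{-2}$. Definition (basis). Let $A\subseteq B$ be one of these two types of inclusion, with its Markov trace $tr$ of modulus $\tau$ and $tr$-preserving conditional expectation $E_A:B\to A$. A finite set $\{\lambda_i : 1\le i\le n\}\subseteq B$ is a basis for $B/A$ if it satisfies any one of the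 following equivalent conditions: (1) the matrix $Q=(E_A(\lambda_i\lambda_j^* ))_{i,j}$ is a projection in $M_n(A)$ with $tr_{M_n(A)}(Q)=\tau^{-1}/n$, where $tr_{M_n(A)}((a_{ij}))=\frac1n\sum_i tr(a_{ii})$; (2) $\sum_{i=1}^n\lambda_i^*e_A\lambda_i=1$; (3) $x=\sum_{i=1}^n E_A(x\lambda_i^* )\lambda_i$ for every $x\in B$.
   Formalization: In the finite dimensional case the Markov trace of M ⊆ P is assumed to restrict on M to the Markov trace of N ⊆ M (equivalently ‖GH‖=‖G‖‖H‖); otherwise the claim fails, e.g. for G=[1 1], H=[[1,0],[1,1]]. For II_1 factors this is automatic. *)

theory Defs
  imports "HOL-Analysis.Analysis"
begin

section \<open>Complex Hilbert spaces and their bounded operators\<close>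

text \<open>A complex Hilbert space is a real Hilbert space with a compatible complex scalar multiplication;
  the norm and the topology are those of the real part of the complex inner product.
  The complex inner product is linear in its first argument.\<close>

class complex_hilbert = real_inner + complete_space +
  fixes scaleC :: "complex \<Rightarrow> 'a \<Rightarrow> 'a" (infixr "*\<^sub>C" 75)
    and cinner :: "'a \<Rightarrow> 'a \<Rightarrow> complex"
  assumes scaleC_add_right: "c *\<^sub>C (x + y) = c *\<^sub>C x + c *\<^sub>C y"
    and scaleC_add_left: "(c + d) *\<^sub>C x = c *\<^sub>C x + d *\<^sub>C x"
    and scaleC_scaleC: "c *\<^sub>C (d *\<^sub>C x) = (c * d) *\<^sub>C x"
    and scaleC_of_real: "complex_of_real r *\<^sub>C x = r *\<^sub>R x"
    and cinner_commute: "cinner x y = cnj (cinner y x)"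
    and cinner_add_left: "cinner (x + y) z = cinner x z + cinner y z"
    and cinner_scaleC_left: "cinner (c *\<^sub>C x) y = c * cinner x y"
    and Re_cinner: "Re (cinner x y) = x \<bullet> y"

text \<open>Operators are bounded real-linear maps; the algebra \<open>B(H)\<close> consists of those which are
  complex-linear. All operator algebras below are subsets of it.\<close>

type_synonym 'h oper = "'h \<Rightarrow>\<^sub>L 'h"

definition bounded_operators :: "'h::complex_hilbert oper set" where
  "bounded_operators = {T. \<forall>c x. blinfun_apply T (c *\<^sub>C x) = c *\<^sub>C blinfun_apply T x}"

definition scale_op :: "complex \<Rightarrow> 'h::complex_hilbert oper \<Rightarrow> 'h oper" where
  "scale_op c T = Blinfun (\<lambda>x. c *\<^sub>C blinfun_apply T x)"

definition adj :: "'h::complex_hilbert oper \<Rightarrow> 'h oper" where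
  "adj T = (THE S. S \<in> bounded_operators \<and>
     (\<forall>x y. cinner (blinfun_apply T x) y = cinner x (blinfun_apply S y)))"

definition op_nonneg :: "'h::complex_hilbert oper \<Rightarrow> bool" where
  "op_nonneg T \<longleftrightarrow> T \<in> bounded_operators \<and>
     (\<forall>x. cinner (blinfun_apply T x) x \<in> \<real>\<^sub>\<ge>\<^sub>0)"

definition is_proj :: "'h::complex_hilbert oper \<Rightarrow> bool" where
  "is_proj p \<longleftrightarrow> p \<in> bounded_operators \<and> p o\<^sub>L p = p \<and> adj p = p"

text \<open>The orthogonal projection onto a closed complex subspace.\<close>

definition proj_onto :: "'h::complex_hilbert set \<Rightarrow> 'h oper" where
  "proj_onto S = (THE p. p \<in> bounded_operators \<and>
     (\<forall>x. blinfun_apply p x \<in> S \<and> (\<forall>y\<in>S. cinner (x - blinfun_apply p x) y = 0)))"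

definition complex_linear_on :: "'h::complex_hilbert oper set \<Rightarrow> ('h oper \<Rightarrow> complex) \<Rightarrow> bool" where
  "complex_linear_on B f \<longleftrightarrow>
     (\<forall>x\<in>B. \<forall>y\<in>B. f (x + y) = f x + f y) \<and> (\<forall>c. \<forall>x\<in>B. f (scale_op c x) = c * f x)"


section \<open>Von Neumann algebras and traces\<close>

definition commutant :: "'h::complex_hilbert oper set \<Rightarrow> 'h oper set" where
  "commutant S = {T \<in> bounded_operators. \<forall>x\<in>S. T o\<^sub>L x = x o\<^sub>L T}"

definition von_neumann_algebra :: "'h::complex_hilbert oper set \<Rightarrow> bool" where
  "von_neumann_algebra B \<longleftrightarrow> B \<subseteq> bounded_operators \<and> (\<forall>x\<in>B. adj x \<in> B) \<and>
     commutant (commutant B) = B"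

definition finite_dimensional :: "'h::complex_hilbert oper set \<Rightarrow> bool" where
  "finite_dimensional B \<longleftrightarrow> (\<exists>S. finite S \<and> B \<subseteq> span S)"

definition positive_trace :: "'h::complex_hilbert oper set \<Rightarrow> ('h oper \<Rightarrow> complex) \<Rightarrow> bool" where
  "positive_trace B tr \<longleftrightarrow> complex_linear_on B tr \<and>
     (\<forall>x\<in>B. op_nonneg x \<longrightarrow> tr x \<in> \<real>\<^sub>\<ge>\<^sub>0) \<and>
     (\<forall>x\<in>B. \<forall>y\<in>B. tr (x o\<^sub>L y) = tr (y o\<^sub>L x))"

text \<open>Normality: the functional preserves least upper bounds of upward directed families of
  self-adjoint elements.\<close>

definition op_lub_in :: "'h::complex_hilbert oper set \<Rightarrow> 'h oper set \<Rightarrow> 'h oper \<Rightarrow> bool" where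
  "op_lub_in B D s \<longleftrightarrow> s \<in> B \<and> (\<forall>d\<in>D. op_nonneg (s - d)) \<and>
     (\<forall>u\<in>B. (\<forall>d\<in>D. op_nonneg (u - d)) \<longrightarrow> op_nonneg (u - s))"

definition normal_functional :: "'h::complex_hilbert oper set \<Rightarrow> ('h oper \<Rightarrow> complex) \<Rightarrow> bool" where
  "normal_functional B f \<longleftrightarrow>
     (\<forall>D s. D \<noteq> {} \<and> D \<subseteq> B \<and> (\<forall>x\<in>D. adj x = x) \<and>
        (\<forall>x\<in>D. \<forall>y\<in>D. \<exists>z\<in>D. op_nonneg (z - x) \<and> op_nonneg (z - y)) \<and> op_lub_in B D s
        \<longrightarrow> Re (f s) = Sup ((\<lambda>x. Re (f x)) ` D))"

definition tracial_state :: "'h::complex_hilbert oper set \<Rightarrow> ('h oper \<Rightarrow> complex) \<Rightarrow> bool" where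
  "tracial_state B tr \<longleftrightarrow> positive_trace B tr \<and> tr id_blinfun = 1 \<and>
     (\<forall>x\<in>B. tr (adj x o\<^sub>L x) = 0 \<longrightarrow> x = 0) \<and> normal_functional B tr"
  \<comment> \<open>faithful normal tracial state\<close>

definition factor :: "'h::complex_hilbert oper set \<Rightarrow> bool" where
  "factor B \<longleftrightarrow> von_neumann_algebra B \<and> B \<inter> commutant B = range (\<lambda>c. scale_op c id_blinfun)"

definition II1_factor :: "'h::complex_hilbert oper set \<Rightarrow> bool" where
  "II1_factor B \<longleftrightarrow> factor B \<and> \<not> finite_dimensional B \<and> (\<exists>tr. tracial_state B tr)"


section \<open>The space \<open>L\<^sup>2(B, tr)\<close> and the basic construction\<close>

text \<open>\<open>L\<^sup>2(B, tr)\<close> is the completion of \<open>B\<close> for the inner product \<open>tr (y\<^sup>* x)\<close>. A completion is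
  specified by its canonical map \<open>\<eta>\<close> from \<open>B\<close> into a Hilbert space, which is isometric with dense
  range; it is unique up to a unitary intertwining the maps.\<close>

definition L2_space ::
    "'h::complex_hilbert oper set \<Rightarrow> ('h oper \<Rightarrow> complex) \<Rightarrow> ('h oper \<Rightarrow> 'k::complex_hilbert) \<Rightarrow> bool" where
  "L2_space B tr \<eta> \<longleftrightarrow>
     (\<forall>x\<in>B. \<forall>y\<in>B. \<eta> (x + y) = \<eta> x + \<eta> y) \<and>
     (\<forall>c. \<forall>x\<in>B. \<eta> (scale_op c x) = c *\<^sub>C \<eta> x) \<and>
     (\<forall>x\<in>B. \<forall>y\<in>B. cinner (\<eta> x) (\<eta> y) = tr (adj y o\<^sub>L x)) \<and>
     closure (\<eta> ` B) = UNIV"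

text \<open>The operator on \<open>L\<^sup>2(B, tr)\<close> which extends left multiplication by \<open>b\<close>.\<close>

definition lmult ::
    "'h::complex_hilbert oper set \<Rightarrow> ('h oper \<Rightarrow> 'k::complex_hilbert) \<Rightarrow> 'h oper \<Rightarrow> 'k oper" where
  "lmult B \<eta> b = (THE T. T \<in> bounded_operators \<and> (\<forall>x\<in>B. blinfun_apply T (\<eta> x) = \<eta> (b o\<^sub>L x)))"

text \<open>\<open>L\<^sup>2(A, tr)\<close> is the closure of \<open>A\<close> in \<open>L\<^sup>2(B, tr)\<close>.\<close>

definition jones_projection ::
    "'h::complex_hilbert oper set \<Rightarrow> ('h oper \<Rightarrow> 'k::complex_hilbert) \<Rightarrow> 'k oper" where
  "jones_projection A \<eta> = proj_onto (closure (\<eta> ` A))"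

definition basic_construction ::
    "'h::complex_hilbert oper set \<Rightarrow> 'h oper set \<Rightarrow> ('h oper \<Rightarrow> 'k::complex_hilbert) \<Rightarrow> 'k oper set" where
  "basic_construction A B \<eta> =
     von_neumann_algebra hull (insert (jones_projection A \<eta>) (lmult B \<eta> ` B))"

definition markov_trace ::
    "'h::complex_hilbert oper set \<Rightarrow> 'h oper set \<Rightarrow> ('h oper \<Rightarrow> complex) \<Rightarrow>
     ('h oper \<Rightarrow> 'k::complex_hilbert) \<Rightarrow> real \<Rightarrow> bool" where
  "markov_trace A B tr \<eta> \<tau> \<longleftrightarrow> tracial_state B tr \<and> \<tau> > 0 \<and>
     (\<exists>Tr. positive_trace (basic_construction A B \<eta>) Tr \<and>
        (\<forall>x\<in>B. Tr (lmult B \<eta> x) = tr x) \<and>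
        (\<forall>x\<in>B. Tr (lmult B \<eta> x o\<^sub>L jones_projection A \<eta>) = of_real \<tau> * tr x))"

definition conditional_expectation ::
    "'h::complex_hilbert oper set \<Rightarrow> 'h oper set \<Rightarrow> ('h oper \<Rightarrow> complex) \<Rightarrow> ('h oper \<Rightarrow> 'h oper) \<Rightarrow> bool" where
  "conditional_expectation A B tr E \<longleftrightarrow>
     (\<forall>x\<in>B. E x \<in> A) \<and> (\<forall>a\<in>A. E a = a) \<and>
     (\<forall>x\<in>B. \<forall>y\<in>B. E (x + y) = E x + E y) \<and>
     (\<forall>c. \<forall>x\<in>B. E (scale_op c x) = scale_op c (E x)) \<and>
     (\<forall>x\<in>B. op_nonneg x \<longrightarrow> op_nonneg (E x)) \<and>
     (\<forall>a\<in>A. \<forall>b\<in>A. \<forall>x\<in>B. E (a o\<^sub>L x o\<^sub>L b) = a o\<^sub>L E x o\<^sub>L b) \<and>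
     (\<forall>x\<in>B. tr (E x) = tr x)"
  \<comment> \<open>the trace-preserving one, unique as a map on \<open>B\<close>\<close>


section \<open>Index of factors and connectedness of finite dimensional inclusions\<close>

text \<open>Murray and von Neumann's coupling constant (dimension) of the Hilbert space on which the
  \<open>II\<^sub>1\<close> factor \<open>R\<close> acts: \<open>\<infinity>\<close> if the commutant \<open>R'\<close> is not finite, and otherwise
  \<open>tr\<^sub>R [R'\<xi>] / tr\<^sub>R\<^sub>' [R\<xi>]\<close>, which does not depend on the vector \<open>\<xi> \<noteq> 0\<close>.\<close>

definition coupling_constant :: "'k::complex_hilbert oper set \<Rightarrow> ereal" where
  "coupling_constant R =
     (if \<exists>t'. tracial_state (commutant R) t'
      then ereal (THE d. \<exists>t t' \<xi>. tracial_state R t \<and> tracial_state (commutant R) t' \<and> \<xi> \<noteq> 0 \<and>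
             d = Re (t (proj_onto (closure ((\<lambda>T. blinfun_apply T \<xi>) ` commutant R))))
               / Re (t' (proj_onto (closure ((\<lambda>T. blinfun_apply T \<xi>) ` R)))))
      else \<infinity>)"

definition jones_index ::
    "'h::complex_hilbert oper set \<Rightarrow> 'h oper set \<Rightarrow> ('h oper \<Rightarrow> 'k::complex_hilbert) \<Rightarrow> ereal" where
  "jones_index A B \<eta> = coupling_constant (lmult B \<eta> ` A)"

definition minimal_projections :: "'h::complex_hilbert oper set \<Rightarrow> 'h oper set" where
  "minimal_projections B = {p \<in> B. is_proj p \<and> p \<noteq> 0 \<and>
     (\<forall>q\<in>B. is_proj q \<and> q o\<^sub>L p = q \<longrightarrow> q = 0 \<or> q = p)}"

definition minimal_central_projections :: "'h::complex_hilbert oper set \<Rightarrow> 'h oper set" where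
  "minimal_central_projections B = minimal_projections (B \<inter> commutant B)"

definition proj_rank :: "'h::complex_hilbert oper set \<Rightarrow> 'h oper \<Rightarrow> nat" where
  "proj_rank B r = Max {card F | F. finite F \<and> F \<subseteq> B \<and>
     (\<forall>p\<in>F. is_proj p \<and> p \<noteq> 0 \<and> p o\<^sub>L r = p) \<and>
     (\<forall>p\<in>F. \<forall>q\<in>F. p \<noteq> q \<longrightarrow> p o\<^sub>L q = 0)}"

text \<open>For minimal central projections \<open>p\<close> of \<open>A\<close> and \<open>q\<close> of \<open>B\<close>, the entry of the inclusion matrix is
  the multiplicity of the simple summand \<open>A p\<close> in \<open>B q\<close>, that is, the rank in the matrix algebra
  \<open>B q\<close> of \<open>f q\<close> for a minimal projection \<open>f\<close> of \<open>A p\<close>.\<close>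

definition inclusion_matrix ::
    "'h::complex_hilbert oper set \<Rightarrow> 'h oper set \<Rightarrow> 'h oper \<Rightarrow> 'h oper \<Rightarrow> nat" where
  "inclusion_matrix A B p q =
     proj_rank B ((SOME f. f \<in> minimal_projections A \<and> f o\<^sub>L p = f) o\<^sub>L q)"

definition bratteli_edges ::
    "'h::complex_hilbert oper set \<Rightarrow> 'h oper set \<Rightarrow> (('h oper + 'h oper) \<times> ('h oper + 'h oper)) set" where
  "bratteli_edges A B = {(Inl p, Inr q) | p q.
     p \<in> minimal_central_projections A \<and> q \<in> minimal_central_projections B \<and>
     inclusion_matrix A B p q \<noteq> 0}"

definition connected_inclusion :: "'h::complex_hilbert oper set \<Rightarrow> 'h oper set \<Rightarrow> bool" where
  "connected_inclusion A B \<longleftrightarrow>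
     (\<forall>v \<in> minimal_central_projections A <+> minimal_central_projections B.
      \<forall>w \<in> minimal_central_projections A <+> minimal_central_projections B.
        (v, w) \<in> (bratteli_edges A B \<union> (bratteli_edges A B)\<inverse>)\<^sup>*)"


section \<open>Bases\<close>

definition basis_matrix_condition ::
    "('h::complex_hilbert oper \<Rightarrow> complex) \<Rightarrow> real \<Rightarrow> ('h oper \<Rightarrow> 'h oper) \<Rightarrow>
     'i set \<Rightarrow> ('i \<Rightarrow> 'h oper) \<Rightarrow> bool" where
  "basis_matrix_condition tr \<tau> E I lam \<longleftrightarrow>
     (let Q = (\<lambda>i j. E (lam i o\<^sub>L adj (lam j))) in
       (\<forall>i\<in>I. \<forall>j\<in>I. (\<Sum>k\<in>I. Q i k o\<^sub>L Q k j) = Q i j) \<and>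
       (\<forall>i\<in>I. \<forall>j\<in>I. adj (Q j i) = Q i j) \<and>
       (\<Sum>i\<in>I. tr (Q i i)) / of_nat (card I) = of_real (inverse \<tau>) / of_nat (card I))"

definition basis_projection_condition ::
    "'h::complex_hilbert oper set \<Rightarrow> 'h oper set \<Rightarrow> ('h oper \<Rightarrow> 'k::complex_hilbert) \<Rightarrow>
     'i set \<Rightarrow> ('i \<Rightarrow> 'h oper) \<Rightarrow> bool" where
  "basis_projection_condition A B \<eta> I lam \<longleftrightarrow>
     (\<Sum>i\<in>I. lmult B \<eta> (adj (lam i)) o\<^sub>L jones_projection A \<eta> o\<^sub>L lmult B \<eta> (lam i)) = id_blinfun"

definition basis_expansion_condition ::
    "'h::complex_hilbert oper set \<Rightarrow> ('h oper \<Rightarrow> 'h oper) \<Rightarrow> 'i set \<Rightarrow> ('i \<Rightarrow> 'h oper) \<Rightarrow> bool" where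
  "basis_expansion_condition B E I lam \<longleftrightarrow>
     (\<forall>x\<in>B. x = (\<Sum>i\<in>I. E (x o\<^sub>L adj (lam i)) o\<^sub>L lam i))"

text \<open>The three conditions are equivalent; any one of them may be used to verify a basis. The trace
  \<open>tr\<close> on \<open>B\<close> is required to be the Markov trace of the inclusion; its modulus \<open>\<tau>\<close>, and the
  trace-preserving conditional expectation \<open>E\<close> on \<open>B\<close>, are determined by it.\<close>

definition is_basis ::
    "'h::complex_hilbert oper set \<Rightarrow> 'h oper set \<Rightarrow> ('h oper \<Rightarrow> complex) \<Rightarrow>
     ('h oper \<Rightarrow> 'k::complex_hilbert) \<Rightarrow> 'i set \<Rightarrow> ('i \<Rightarrow> 'h oper) \<Rightarrow> bool" where
  "is_basis A B tr \<eta> I lam \<longleftrightarrow> finite I \<and> I \<noteq> {} \<and> (\<forall>i\<in>I. lam i \<in> B) \<and>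
     (\<exists>\<tau> E. markov_trace A B tr \<eta> \<tau> \<and> conditional_expectation A B tr E \<and>
        (basis_matrix_condition tr \<tau> E I lam \<or>
         basis_projection_condition A B \<eta> I lam \<or>
         basis_expansion_condition B E I lam))"

end

theory Submission
  imports Defs
begin

text \<open>
  Expansions compose: substituting the expansion over \<open>\<lambda>\<close> of each coefficient \<open>E\<^sub>M(x \<mu>\<^sub>j\<^sup>*)\<close> into
  the expansion of \<open>x\<close> over \<open>\<mu>\<close> gives the expansion of \<open>x\<close> over the products, with conditional
  expectation \<open>E\<^sub>N E\<^sub>M\<close>. The remaining point is that \<open>tr\<close> is a Markov trace for \<open>N \<subseteq> P\<close>. The Markov
  property of the two steps gives \<open>\<Sum>\<^sub>i \<lambda>\<^sub>i\<^sup>* \<lambda>\<^sub>i = \<sigma>\<^sup>-\<^sup>1\<close> and \<open>\<Sum>\<^sub>j \<mu>\<^sub>j\<^sup>* \<mu>\<^sub>j = \<rho>\<^sup>-\<^sup>1\<close>, so the products \<open>\<nu>\<^sub>k\<close> satisfy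
  \<open>\<Sum>\<^sub>k \<nu>\<^sub>k\<^sup>* \<nu>\<^sub>k = (\<sigma> \<rho>)\<^sup>-\<^sup>1\<close>. For any finite family with an expansion and with this normalisation,
  \<open>T \<mapsto> \<sigma> \<rho> \<Sum>\<^sub>k \<langle>T \<nu>\<^sub>k\<^sup>*, \<nu>\<^sub>k\<^sup>*\<rangle>\<close> is a trace on the commutant of the right action of \<open>N\<close> on \<open>L\<^sup>2(P)\<close>, which
  contains the basic construction, and it is a Markov extension of \<open>tr\<close> of modulus \<open>\<sigma> \<rho>\<close>.
\<close>

section \<open>Extension from dense subspaces and Riesz representation\<close>

lemma continuous_eq_on_dense:
  fixes f g :: "'a::topological_space \<Rightarrow> 'b::t2_space"
  assumes "continuous_on UNIV f" "continuous_on UNIV g" "closure D = UNIV" "\<And>x. x \<in> D \<Longrightarrow> f x = g x"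
  shows "f x = g x"
proof -
  have "closed {x. f x = g x}"
    using assms by (intro closed_Collect_eq)
  moreover have "D \<subseteq> {x. f x = g x}" using assms by auto
  ultimately have "closure D \<subseteq> {x. f x = g x}" by (rule closure_minimal[rotated])
  then show ?thesis using assms by auto
qed

text \<open>The bound makes \<open>f\<close> constant on the fibres of \<open>\<eta>\<close>, so it
  factors through the image; the factor is Lipschitz there and extends by completeness. Linearity is
  asked over the reals only, so that the conjugate-linear map \<open>J\<close> can be obtained in
  the same way.\<close>

lemma dense_extension:
  fixes \<eta> :: "'a::real_vector \<Rightarrow> 'b::real_normed_vector" and f :: "'a \<Rightarrow> 'c::{real_normed_vector, complete_space}"
  assumes B: "subspace B"
    and \<eta>: "\<And>x y. x \<in> B \<Longrightarrow> y \<in> B \<Longrightarrow> \<eta> (x + y) = \<eta> x + \<eta> y" "\<And>r x. x \<in> B \<Longrightarrow> \<eta> (r *\<^sub>R x) = r *\<^sub>R \<eta> x"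
    and f: "\<And>x y. x \<in> B \<Longrightarrow> y \<in> B \<Longrightarrow> f (x + y) = f x + f y" "\<And>r x. x \<in> B \<Longrightarrow> f (r *\<^sub>R x) = r *\<^sub>R f x"
    and le: "\<And>x. x \<in> B \<Longrightarrow> norm (f x) \<le> K * norm (\<eta> x)"
    and dense: "closure (\<eta> ` B) = UNIV"
  shows "\<exists>T :: 'b \<Rightarrow>\<^sub>L 'c. \<forall>x\<in>B. blinfun_apply T (\<eta> x) = f x"
proof -
  define g where "g y = f (inv_into B \<eta> y)" for y
  have diff: "norm (f x - f y) \<le> K * norm (\<eta> x - \<eta> y)" if "x \<in> B" "y \<in> B" for x y
  proof -
    have my: "-y \<in> B" using that B by (metis subspace_neg)
    have "f (x - y) = f x - f y" "\<eta> (x - y) = \<eta> x - \<eta> y"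
      using \<eta>(1)[of x "-y"] f(1)[of x "-y"] \<eta>(2)[of y "-1"] f(2)[of y "-1"] that my by auto
    then show ?thesis using le[of "x - y"] that B by (metis subspace_diff)
  qed
  have g: "g (\<eta> x) = f x" if "x \<in> B" for x
  proof -
    have i: "inv_into B \<eta> (\<eta> x) \<in> B" "\<eta> (inv_into B \<eta> (\<eta> x)) = \<eta> x"
      using that by (auto intro: inv_into_into f_inv_into_f)
    show ?thesis using diff[OF i(1) that] i(2) by (simp add: g_def)
  qed
  have "uniformly_continuous_on (\<eta> ` B) g"
  proof (rule lipschitz_on_uniformly_continuous)
    show "\<bar>K\<bar>-lipschitz_on (\<eta> ` B) g"
    proof (rule lipschitz_onI)
      fix x y assume "x \<in> \<eta> ` B" "y \<in> \<eta> ` B"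
      then obtain a b where "a \<in> B" "b \<in> B" "x = \<eta> a" "y = \<eta> b" by auto
      then show "dist (g x) (g y) \<le> \<bar>K\<bar> * dist x y"
        using diff[of a b] g by (auto simp: dist_norm intro: order_trans[OF _ mult_right_mono[OF abs_ge_self]])
    qed auto
  qed
  then obtain h where h: "uniformly_continuous_on UNIV h" "\<And>x. x \<in> \<eta> ` B \<Longrightarrow> h x = g x"
    by (rule uniformly_continuous_on_extension_on_closure) (use dense in auto)
  have hc: "continuous_on UNIV h" using h(1) by (rule uniformly_continuous_imp_continuous)
  have hc': "continuous_on S (\<lambda>x. h (u x))" if "continuous_on S u" for u :: "'b \<Rightarrow> 'b" and S
    using continuous_on_compose2[OF hc that] by auto
  have h\<eta>: "h (\<eta> x) = f x" if "x \<in> B" for x using h(2) g that by auto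
  \<comment> \<open>Additivity passes to the closure one variable at a time: at this stage the
    second summand still lies in the image of \<open>B\<close>.\<close>
  have add1: "h (x + \<eta> b) = h x + h (\<eta> b)" if b: "b \<in> B" for x b
    by (rule continuous_eq_on_dense[OF _ _ dense, of "\<lambda>x. h (x + \<eta> b)" "\<lambda>x. h x + h (\<eta> b)"])
       (use b B in \<open>auto intro!: continuous_intros hc' simp: \<eta>(1)[symmetric] h\<eta> f subspace_add\<close>)
  have add: "h (x + y) = h x + h y" for x y
    by (rule continuous_eq_on_dense[OF _ _ dense, of "\<lambda>y. h (x + y)" "\<lambda>y. h x + h y"])
       (auto intro!: continuous_intros hc' simp: add1)
  have scale: "h (r *\<^sub>R x) = r *\<^sub>R h x" for r x
    by (rule continuous_eq_on_dense[OF _ _ dense, of "\<lambda>x. h (r *\<^sub>R x)" "\<lambda>x. r *\<^sub>R h x"])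
       (use B in \<open>auto intro!: continuous_intros hc' simp: \<eta>(2)[symmetric] h\<eta> f subspace_scale\<close>)
  have cl: "closed {x. norm (h x) \<le> K * norm x}"
    by (intro closed_Collect_le continuous_intros hc)
  have "closure (\<eta> ` B) \<subseteq> {x. norm (h x) \<le> K * norm x}"
    by (rule closure_minimal[OF _ cl]) (auto simp: h\<eta> le)
  then have "bounded_linear h"
    using dense by (intro bounded_linear_intro[of h K]) (auto simp: add scale mult.commute)
  then show ?thesis
    using h\<eta> by (intro exI[of _ "Blinfun h"]) (auto simp: bounded_linear_Blinfun_apply)
qed

text \<open>The representing vector is the minimiser of the quadratic functional \<open>F\<close>,
  since the first variation of \<open>F\<close> vanishes there. A minimiser exists because the
  parallelogram law makes minimising sequences Cauchy.\<close>

lemma riesz_representation: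
  fixes f :: "'a::{real_inner, complete_space} \<Rightarrow> real"
  assumes "bounded_linear f"
  shows "\<exists>v. \<forall>x. f x = x \<bullet> v"
proof -
  interpret bounded_linear f by fact
  define F where "F x = (norm x)\<^sup>2 - 2 * f x" for x
  obtain K where K: "\<And>x. norm (f x) \<le> norm x * K" using bounded by blast
  have lower: "F x \<ge> - K\<^sup>2" for x
  proof -
    have "0 \<le> (norm x - K)\<^sup>2" by simp
    moreover have "f x \<le> norm x * K" using K[of x] by simp
    ultimately show ?thesis by (simp add: F_def power2_eq_square algebra_simps)
  qed
  have para: "F x + F y - 2 * F ((1/2) *\<^sub>R (x + y)) = (norm (x - y))\<^sup>2 / 2" for x y
    by (simp add: F_def power2_norm_eq_inner add scale inner_simps inner_commute algebra_simps)
  define d where "d = Inf (range F)"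
  have bdd: "bdd_below (range F)" using lower by (auto intro!: bdd_belowI2)
  have d_le: "d \<le> F x" for x unfolding d_def using bdd by (auto intro: cInf_lower)
  have "\<exists>x. F x < d + 1 / (Suc n)" for n
    using cInf_lessD[of "range F" "d + 1 / (Suc n)"] by (auto simp: d_def)
  then obtain X where X: "\<And>n. F (X n) < d + 1 / (Suc n)" by metis
  \<comment> \<open>Two values within \<open>1 / (Suc N)\<close> of the infimum, set against a
    midpoint value of at least \<open>d\<close>, bound half of the squared distance by
    \<open>2 / (Suc N)\<close>; hence the 4.\<close>
  have close: "(norm (X m - X n))\<^sup>2 < 4 / (Suc N)" if "m \<ge> N" "n \<ge> N" for m n N
  proof -
    have "1 / (Suc m) \<le> 1 / (Suc N)" "1 / (Suc n) \<le> 1 / (Suc N)" using that by (auto intro!: divide_left_mono)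
    then have "F (X m) < d + 1 / (Suc N)" "F (X n) < d + 1 / (Suc N)"
      using X[of m] X[of n] by linarith+
    then have "(norm (X m - X n))\<^sup>2 < 4 * (1 / (Suc N))"
      using para[of "X m" "X n"] d_le[of "(1/2) *\<^sub>R (X m + X n)"] by argo
    then show ?thesis by simp
  qed
  have "Cauchy X"
  proof (rule metric_CauchyI)
    fix e :: real assume "e > 0"
    obtain N where N: "4 / (Suc N) < e\<^sup>2"
      using reals_Archimedean[of "e\<^sup>2 / 4"] \<open>e > 0\<close> by (auto simp: field_simps)
    have "dist (X m) (X n) < e" if "m \<ge> N" "n \<ge> N" for m n
      using close[OF that] N \<open>e > 0\<close> by (auto simp: dist_norm intro: power2_less_imp_less)
    then show "\<exists>M. \<forall>m\<ge>M. \<forall>n\<ge>M. dist (X m) (X n) < e" by blast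
  qed
  then obtain v where v: "X \<longlonglongrightarrow> v" using Cauchy_convergent convergent_def by blast
  have "(\<lambda>n. F (X n)) \<longlonglongrightarrow> F v"
    unfolding F_def by (intro tendsto_intros v tendsto)
  moreover have "(\<lambda>n. d + 1 / (Suc n)) \<longlonglongrightarrow> d + 0"
    by (intro tendsto_intros LIMSEQ_Suc[OF lim_1_over_n] )
  ultimately have "F v \<le> d + 0"
    by (rule LIMSEQ_le) (use X less_imp_le in blast)
  then have min: "F v \<le> F x" for x using d_le[of x] by simp
  have "f h = h \<bullet> v" for h
  proof (rule ccontr)
    assume ne: "f h \<noteq> h \<bullet> v"
    define c where "c = f h - h \<bullet> v"
    have h0: "h \<noteq> 0" using ne zero by auto
    \<comment> \<open>The value of \<open>t\<close> that minimises the quadratic polynomial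
      \<open>F (v + t *\<^sub>R h)\<close>.\<close>
    define t where "t = c / (h \<bullet> h)"
    have "F (v + t *\<^sub>R h) = F v - 2 * t * c + t\<^sup>2 * (h \<bullet> h)"
      by (simp add: F_def power2_norm_eq_inner add scale inner_simps inner_commute algebra_simps c_def power2_eq_square[of t])
    also have "\<dots> = F v - c\<^sup>2 / (h \<bullet> h)"
      using h0 by (simp add: t_def power2_eq_square field_simps)
    also have "\<dots> < F v" using h0 ne by (simp add: c_def)
    finally show False using min[of "v + t *\<^sub>R h"] by simp
  qed
  then show ?thesis by blast
qed

section \<open>Adjoints of bounded operators\<close>

lemma cinner_zero_left [simp]: "cinner 0 y = 0"
  using cinner_add_left[of 0 0 y] by simp

lemma cinner_zero_right [simp]: "cinner x 0 = 0"
  by (subst cinner_commute) simp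

lemma cinner_add_right: "cinner x (y + z) = cinner x y + cinner x z"
  by (metis cinner_add_left cinner_commute complex_cnj_add)

lemma cinner_scaleC_right: "cinner x (c *\<^sub>C y) = cnj c * cinner x y"
  by (metis cinner_scaleC_left cinner_commute complex_cnj_mult)

lemma cinner_scaleR_left: "cinner (r *\<^sub>R x) y = of_real r * cinner x y"
  by (metis cinner_scaleC_left scaleC_of_real)

lemma cinner_scaleR_right: "cinner x (r *\<^sub>R y) = of_real r * cinner x y"
  by (metis cinner_scaleC_right scaleC_of_real complex_cnj_complex_of_real)

lemma cinner_minus_left: "cinner (- x) y = - cinner x y"
  using cinner_scaleR_left[of "-1" x y] by simp

lemma cinner_minus_right: "cinner x (- y) = - cinner x y"
  using cinner_scaleR_right[of x "-1" y] by simp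

lemma cinner_diff_left: "cinner (x - y) z = cinner x z - cinner y z"
  using cinner_add_left[of x "- y" z] by (simp add: cinner_minus_left)

lemma cinner_diff_right: "cinner x (y - z) = cinner x y - cinner x z"
  using cinner_add_right[of x y "- z"] by (simp add: cinner_minus_right)

lemma cinner_sum_right: "cinner x (\<Sum>i\<in>I. f i) = (\<Sum>i\<in>I. cinner x (f i))"
  by (induction I rule: infinite_finite_induct) (auto simp: cinner_add_right)

lemma cinner_self: "cinner x x = of_real ((norm x)\<^sup>2)"
proof -
  have "Im (cinner x x) = - Im (cinner x x)"
    using arg_cong[OF cinner_commute[of x x], of Im] by (simp only: cnj.sel)
  then have "Im (cinner x x) = 0" by linarith
  then show ?thesis
    by (simp add: complex_eq_iff Re_cinner power2_norm_eq_inner)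
qed

lemma cinner_self_nonneg: "cinner x x \<in> \<real>\<^sub>\<ge>\<^sub>0"
  by (simp add: cinner_self)

lemma cinner_eqI: "(\<And>y. cinner x y = cinner z y) \<Longrightarrow> x = z"
  using cinner_self[of "x - z"] by (simp add: cinner_diff_left)

lemma cinner_eqI_right: "(\<And>y. cinner y x = cinner y z) \<Longrightarrow> x = z"
  by (metis cinner_commute cinner_eqI)

lemma scaleC_zero_right [simp]: "c *\<^sub>C 0 = (0 :: 'a :: complex_hilbert)"
  using scaleC_add_right[of c 0 "0::'a"] by simp

lemma scaleC_sum_right: "c *\<^sub>C (\<Sum>i\<in>I. f i) = (\<Sum>i\<in>I. c *\<^sub>C (f i :: 'a :: complex_hilbert))"
  by (induction I rule: infinite_finite_induct) (auto simp: scaleC_add_right)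

lemma scaleC_minus_one: "(-1) *\<^sub>C x = - x"
  using scaleC_of_real[of "-1" x] by simp

lemma scaleC_scaleR_commute: "c *\<^sub>C (r *\<^sub>R x) = r *\<^sub>R (c *\<^sub>C x)"
  by (metis scaleC_of_real scaleC_scaleC mult.commute)

lemma norm_scaleC: "norm (c *\<^sub>C x) = cmod c * norm x"
proof -
  have "complex_of_real ((norm (c *\<^sub>C x))\<^sup>2) = of_real ((cmod c * norm x)\<^sup>2)"
    by (simp only: cinner_self[symmetric] cinner_scaleC_left cinner_scaleC_right power_mult_distrib
        of_real_mult complex_norm_square mult_ac)
  then have "(norm (c *\<^sub>C x))\<^sup>2 = (cmod c * norm x)\<^sup>2"
    using of_real_eq_iff by blast
  then show ?thesis by (simp add: power2_eq_iff_nonneg)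
qed

lemma bounded_linear_scaleC: "bounded_linear (\<lambda>x. c *\<^sub>C (x :: 'a :: complex_hilbert))"
  by (rule bounded_linear_intro[where K = "cmod c"])
     (auto simp: scaleC_add_right scaleC_scaleR_commute norm_scaleC mult.commute)

text \<open>Reduces questions about \<open>cinner\<close>, such as continuity and adjunction, to the
  real inner product.\<close>

lemma cinner_inner: "cinner x y = Complex (x \<bullet> y) (x \<bullet> (\<i> *\<^sub>C y))"
  by (simp add: complex_eq_iff Re_cinner[symmetric] cinner_scaleC_right)

lemma continuous_on_scaleC [continuous_intros]:
  "continuous_on S f \<Longrightarrow> continuous_on S (\<lambda>x. c *\<^sub>C (f x :: 'a :: complex_hilbert))"
  by (rule bounded_linear.continuous_on[OF bounded_linear_scaleC])

lemma continuous_on_cinner [continuous_intros]: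
  fixes f g :: "'a :: topological_space \<Rightarrow> 'b :: complex_hilbert"
  shows "continuous_on S f \<Longrightarrow> continuous_on S g \<Longrightarrow> continuous_on S (\<lambda>x. cinner (f x) (g x))"
  unfolding cinner_inner Complex_eq by (intro continuous_intros)

section \<open>Algebra of complex-linear bounded operators\<close>

lemma blinfun_apply_scale_op [simp]: "blinfun_apply (scale_op c T) x = c *\<^sub>C blinfun_apply T x"
  unfolding scale_op_def
  by (subst bounded_linear_Blinfun_apply)
     (auto intro: bounded_linear_compose[OF bounded_linear_scaleC] blinfun.bounded_linear_right)

lemma bounded_operatorsD: "T \<in> bounded_operators \<Longrightarrow> blinfun_apply T (c *\<^sub>C x) = c *\<^sub>C blinfun_apply T x"
  by (simp add: bounded_operators_def)

lemma scaleR_eq_scale_op: "r *\<^sub>R T = scale_op (of_real r) T"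
  by (rule blinfun_eqI) (simp add: scaleC_of_real blinfun.scaleR_left)

lemma scale_op_scale_op [simp]: "scale_op c (scale_op d T) = scale_op (c * d) T"
  by (rule blinfun_eqI) (simp add: scaleC_scaleC)

lemma uminus_eq_scale_op: "- T = scale_op (-1) T"
  by (rule blinfun_eqI) (simp add: scaleC_minus_one blinfun.minus_left)

lemma compose_scale_op_left: "scale_op c T o\<^sub>L S = scale_op c (T o\<^sub>L S)"
  by (rule blinfun_eqI) simp

lemma compose_scale_op_right: "T \<in> bounded_operators \<Longrightarrow> T o\<^sub>L scale_op c S = scale_op c (T o\<^sub>L S)"
  by (rule blinfun_eqI) (simp add: bounded_operatorsD)

lemma scale_op_sum: "scale_op c (\<Sum>i\<in>I. f i) = (\<Sum>i\<in>I. scale_op c (f i))"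
  by (rule blinfun_eqI) (simp add: blinfun.sum_left scaleC_sum_right)

lemmas compose_add_left = bounded_bilinear.add_left[OF bounded_bilinear_blinfun_compose]
lemmas compose_add_right = bounded_bilinear.add_right[OF bounded_bilinear_blinfun_compose]
lemmas compose_diff_left = bounded_bilinear.diff_left[OF bounded_bilinear_blinfun_compose]
lemmas compose_diff_right = bounded_bilinear.diff_right[OF bounded_bilinear_blinfun_compose]
lemmas compose_sum_left = bounded_bilinear.sum_left[OF bounded_bilinear_blinfun_compose]
lemmas compose_sum_right = bounded_bilinear.sum_right[OF bounded_bilinear_blinfun_compose]
lemmas compose_zero_left [simp] = bounded_bilinear.zero_left[OF bounded_bilinear_blinfun_compose]
lemmas compose_zero_right [simp] = bounded_bilinear.zero_right[OF bounded_bilinear_blinfun_compose]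

lemma compose_assoc: "(S o\<^sub>L T) o\<^sub>L U = S o\<^sub>L (T o\<^sub>L U)"
  by (rule blinfun_eqI) simp

lemma id_blinfun_compose [simp]: "id_blinfun o\<^sub>L T = T" "T o\<^sub>L id_blinfun = T"
  by (rule blinfun_eqI; simp)+

lemma bounded_operators_id [simp]: "id_blinfun \<in> bounded_operators"
  by (simp add: bounded_operators_def)

lemma bounded_operators_add [intro]:
  "S \<in> bounded_operators \<Longrightarrow> T \<in> bounded_operators \<Longrightarrow> S + T \<in> bounded_operators"
  by (simp add: bounded_operators_def blinfun.add_left scaleC_add_right)

lemma bounded_operators_compose [intro]:
  "S \<in> bounded_operators \<Longrightarrow> T \<in> bounded_operators \<Longrightarrow> S o\<^sub>L T \<in> bounded_operators"
  by (simp add: bounded_operators_def)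

lemma bounded_operators_scale [intro]: "T \<in> bounded_operators \<Longrightarrow> scale_op c T \<in> bounded_operators"
  by (simp add: bounded_operators_def scaleC_scaleC mult.commute)

lemma bounded_operators_diff [intro]:
  "S \<in> bounded_operators \<Longrightarrow> T \<in> bounded_operators \<Longrightarrow> S - T \<in> bounded_operators"
  using bounded_operators_add[of S "- T"] bounded_operators_scale[of T "-1"]
  by (simp add: uminus_eq_scale_op[symmetric])

text \<open>Riesz representation gives an adjoint for the real inner product only. The imaginary
  part of \<open>cinner x y\<close> is the real inner product of \<open>x\<close> with
  \<open>\<i> *\<^sub>C y\<close>, and complex linearity of \<open>T\<close> lets
  \<open>\<i>\<close> pass through it, so the same map is the complex adjoint.\<close>

lemma adj_exists:
  assumes T: "T \<in> bounded_operators"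
  shows "\<exists>S\<in>bounded_operators. \<forall>x y. cinner (blinfun_apply T x) y = cinner x (blinfun_apply S y)"
proof -
  have "\<exists>v. \<forall>x. blinfun_apply T x \<bullet> y = x \<bullet> v" for y
    by (rule riesz_representation)
       (intro bounded_linear_compose[OF bounded_linear_inner_left] blinfun.bounded_linear_right)
  then obtain s where s: "\<And>x y. blinfun_apply T x \<bullet> y = x \<bullet> s y" by metis
  have inner_eqI: "u = v" if "\<And>x. x \<bullet> u = x \<bullet> v" for u v :: 'a
  proof -
    have "(u - v) \<bullet> (u - v) = 0" using that[of "u - v"] by (simp only: inner_diff_right diff_self)
    then show ?thesis by simp
  qed
  have add: "s (x + y) = s x + s y" for x y
    by (rule inner_eqI) (simp add: s[symmetric] inner_add_right)
  have scale: "s (r *\<^sub>R x) = r *\<^sub>R s x" for r x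
    by (rule inner_eqI) (simp add: s[symmetric])
  have bound: "norm (s y) \<le> norm y * norm T" for y
  proof -
    have "norm (s y) * norm (s y) = blinfun_apply T (s y) \<bullet> y"
      by (simp add: s power2_norm_eq_inner[symmetric] power2_eq_square[symmetric])
    also have "\<dots> \<le> norm (blinfun_apply T (s y)) * norm y" by (rule norm_cauchy_schwarz)
    also have "\<dots> \<le> norm T * norm (s y) * norm y" by (intro mult_right_mono norm_blinfun) auto
    finally have "norm (s y) * norm (s y) \<le> norm (s y) * (norm y * norm T)" by (simp add: mult_ac)
    then show ?thesis by (cases "s y = 0") auto
  qed
  have bl: "bounded_linear s" by (rule bounded_linear_intro[OF add scale bound])
  have c: "cinner (blinfun_apply T x) y = cinner x (s y)" for x y
  proof -
    have i: "u \<bullet> (\<i> *\<^sub>C v) = - ((\<i> *\<^sub>C u) \<bullet> v)" for u v :: 'a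
      by (simp add: Re_cinner[symmetric] cinner_scaleC_left cinner_scaleC_right)
    show ?thesis
      by (simp add: cinner_inner s[symmetric] i bounded_operatorsD[OF T, symmetric])
  qed
  have "s (c *\<^sub>C y) = c *\<^sub>C s y" for c y
    by (rule cinner_eqI_right) (simp add: c[symmetric] cinner_scaleC_right)
  then show ?thesis
    using c bl by (intro bexI[of _ "Blinfun s"]) (auto simp: bounded_operators_def bounded_linear_Blinfun_apply)
qed

lemma adj_eqI:
  assumes "S \<in> bounded_operators" "\<And>x y. cinner (blinfun_apply T x) y = cinner x (blinfun_apply S y)"
  shows "adj T = S"
  unfolding adj_def
proof (rule the_equality)
  fix R assume R: "R \<in> bounded_operators \<and> (\<forall>x y. cinner (blinfun_apply T x) y = cinner x (blinfun_apply R y))"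
  show "R = S"
    by (intro blinfun_eqI cinner_eqI_right) (use R assms in metis)
qed (use assms in auto)

lemma
  assumes "T \<in> bounded_operators"
  shows adj_bounded [intro]: "adj T \<in> bounded_operators"
    and cinner_adj: "cinner (blinfun_apply T x) y = cinner x (blinfun_apply (adj T) y)"
proof -
  obtain S where S: "S \<in> bounded_operators" "\<And>x y. cinner (blinfun_apply T x) y = cinner x (blinfun_apply S y)"
    using adj_exists[OF assms] by blast
  have "adj T = S" using S by (rule adj_eqI)
  then show "adj T \<in> bounded_operators" "cinner (blinfun_apply T x) y = cinner x (blinfun_apply (adj T) y)"
    using S by auto
qed

lemma cinner_adj_left:
  "T \<in> bounded_operators \<Longrightarrow> cinner (blinfun_apply (adj T) x) y = cinner x (blinfun_apply T y)"
  by (metis cinner_adj cinner_commute)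

lemma adj_adj [simp]: "T \<in> bounded_operators \<Longrightarrow> adj (adj T) = T"
  by (rule adj_eqI) (auto simp: cinner_adj_left)

lemma adj_id [simp]: "adj id_blinfun = id_blinfun"
  by (rule adj_eqI) auto

lemma adj_add:
  "S \<in> bounded_operators \<Longrightarrow> T \<in> bounded_operators \<Longrightarrow> adj (S + T) = adj S + adj T"
  by (rule adj_eqI) (auto simp: cinner_adj blinfun.add_left cinner_add_left cinner_add_right)

lemma adj_compose:
  "S \<in> bounded_operators \<Longrightarrow> T \<in> bounded_operators \<Longrightarrow> adj (S o\<^sub>L T) = adj T o\<^sub>L adj S"
  by (rule adj_eqI) (auto simp: cinner_adj)

lemma adj_scale: "T \<in> bounded_operators \<Longrightarrow> adj (scale_op c T) = scale_op (cnj c) (adj T)"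
  by (rule adj_eqI) (auto simp: cinner_adj cinner_scaleC_left cinner_scaleC_right)

lemma adj_diff:
  "S \<in> bounded_operators \<Longrightarrow> T \<in> bounded_operators \<Longrightarrow> adj (S - T) = adj S - adj T"
  using adj_add[of S "- T"] adj_scale[of T "-1"] bounded_operators_scale[of T "-1"]
  by (simp add: uminus_eq_scale_op[symmetric])

lemma op_nonneg_adj_compose: "T \<in> bounded_operators \<Longrightarrow> op_nonneg (adj T o\<^sub>L T)"
  by (auto simp: op_nonneg_def cinner_adj_left cinner_self_nonneg)

lemma op_nonneg_conjugate:
  "op_nonneg S \<Longrightarrow> T \<in> bounded_operators \<Longrightarrow> op_nonneg (adj T o\<^sub>L S o\<^sub>L T)"
  by (auto simp: op_nonneg_def cinner_adj_left)

text \<open>This inequality is used twice: conjugated and traced it bounds left multiplication on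
  the L2 space, and later it squeezes a trace on the basic construction to zero.\<close>

lemma op_nonneg_norm_bound:
  assumes T: "T \<in> bounded_operators"
  shows "op_nonneg (scale_op (of_real ((norm T)\<^sup>2)) id_blinfun - (adj T o\<^sub>L T))"
proof -
  have "cinner (blinfun_apply (scale_op (of_real ((norm T)\<^sup>2)) id_blinfun - (adj T o\<^sub>L T)) x) x \<in> \<real>\<^sub>\<ge>\<^sub>0" for x
  proof -
    have "cinner (blinfun_apply (scale_op (of_real ((norm T)\<^sup>2)) id_blinfun - (adj T o\<^sub>L T)) x) x =
        of_real ((norm T * norm x)\<^sup>2 - (norm (blinfun_apply T x))\<^sup>2)"
      using T by (simp add: blinfun.diff_left cinner_diff_left cinner_scaleC_left cinner_adj_left
          cinner_self[of x] cinner_self[of "blinfun_apply T x"] power_mult_distrib)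
    moreover have "(norm (blinfun_apply T x))\<^sup>2 \<le> (norm T * norm x)\<^sup>2"
      by (intro power_mono norm_blinfun) auto
    ultimately show ?thesis by (metis nonneg_Reals_of_real_iff diff_ge_0_iff_ge)
  qed
  moreover have "scale_op (of_real ((norm T)\<^sup>2)) id_blinfun - (adj T o\<^sub>L T) \<in> bounded_operators"
    using T by (intro bounded_operators_diff bounded_operators_scale bounded_operators_compose adj_bounded) simp_all
  ultimately show ?thesis by (simp add: op_nonneg_def)
qed

lemma bounded_operators_zero [simp]: "0 \<in> bounded_operators"
  by (simp add: bounded_operators_def)

lemma bounded_operators_sum [intro]:
  "(\<And>i. i \<in> I \<Longrightarrow> f i \<in> bounded_operators) \<Longrightarrow> (\<Sum>i\<in>I. f i) \<in> bounded_operators"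
  by (induction I rule: infinite_finite_induct) auto

lemma adj_zero [simp]: "adj 0 = 0"
  by (rule adj_eqI) auto

lemma adj_sum:
  "(\<And>i. i \<in> I \<Longrightarrow> f i \<in> bounded_operators) \<Longrightarrow> adj (\<Sum>i\<in>I. f i) = (\<Sum>i\<in>I. adj (f i))"
  by (induction I rule: infinite_finite_induct) (auto simp: adj_add bounded_operators_sum)

section \<open>Closure properties of von Neumann algebras\<close>

lemma commutant_antimono: "S \<subseteq> T \<Longrightarrow> commutant T \<subseteq> commutant S"
  by (auto simp: commutant_def)

lemma subset_bicommutant: "S \<subseteq> bounded_operators \<Longrightarrow> S \<subseteq> commutant (commutant S)"
  by (auto simp: commutant_def)

text \<open>Commutants reverse inclusions, and a set of complex-linear operators lies in its
  bicommutant; together these collapse the triple commutant to the single one.\<close>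

lemma von_neumann_algebra_commutant:
  assumes S: "S \<subseteq> bounded_operators" and adj: "\<And>x. x \<in> S \<Longrightarrow> adj x \<in> S"
  shows "von_neumann_algebra (commutant S)"
proof -
  have "adj T \<in> commutant S" if T: "T \<in> commutant S" for T
  proof -
    have Tb: "T \<in> bounded_operators" using T by (simp add: commutant_def)
    have "adj T o\<^sub>L x = x o\<^sub>L adj T" if x: "x \<in> S" for x
    proof -
      have xb: "x \<in> bounded_operators" "adj x \<in> bounded_operators" using x S by auto
      have "T o\<^sub>L adj x = adj x o\<^sub>L T" using T adj[OF x] by (simp add: commutant_def)
      then have "adj (T o\<^sub>L adj x) = adj (adj x o\<^sub>L T)" by simp
      then show ?thesis using Tb xb by (simp add: adj_compose)
    qed
    then show ?thesis using Tb by (auto simp: commutant_def)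
  qed
  moreover have "commutant S \<subseteq> bounded_operators" by (auto simp: commutant_def)
  moreover have "commutant (commutant (commutant S)) = commutant S"
    by (intro equalityI commutant_antimono[OF subset_bicommutant[OF S]] subset_bicommutant)
       (auto simp: commutant_def)
  ultimately show ?thesis by (simp add: von_neumann_algebra_def)
qed

lemma commutant_id [simp]: "id_blinfun \<in> commutant S"
  by (simp add: commutant_def)

lemma commutant_add: "S \<in> commutant X \<Longrightarrow> T \<in> commutant X \<Longrightarrow> S + T \<in> commutant X"
  by (auto simp: commutant_def compose_add_left compose_add_right)

lemma commutant_compose: "S \<in> commutant X \<Longrightarrow> T \<in> commutant X \<Longrightarrow> S o\<^sub>L T \<in> commutant X"
  unfolding commutant_def by (auto simp: compose_assoc) (metis compose_assoc)

lemma commutant_scale: "X \<subseteq> bounded_operators \<Longrightarrow> T \<in> commutant X \<Longrightarrow> scale_op c T \<in> commutant X"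
  by (auto simp: commutant_def compose_scale_op_left compose_scale_op_right subset_iff)

context
  fixes B :: "'h::complex_hilbert oper set"
  assumes B: "von_neumann_algebra B"
begin

lemma vn_bounded: "x \<in> B \<Longrightarrow> x \<in> bounded_operators"
  using B by (auto simp: von_neumann_algebra_def)

lemma vn_adj: "x \<in> B \<Longrightarrow> adj x \<in> B"
  using B by (auto simp: von_neumann_algebra_def)

lemma vn_eq_commutant: "B = commutant (commutant B)"
  using B by (simp add: von_neumann_algebra_def)

lemma vn_id: "id_blinfun \<in> B"
  by (subst vn_eq_commutant) simp

lemma vn_add: "x \<in> B \<Longrightarrow> y \<in> B \<Longrightarrow> x + y \<in> B"
  using commutant_add[of x "commutant B" y] vn_eq_commutant by simp

lemma vn_compose: "x \<in> B \<Longrightarrow> y \<in> B \<Longrightarrow> x o\<^sub>L y \<in> B"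
  using commutant_compose[of x "commutant B" y] vn_eq_commutant by simp

lemma vn_scale: "x \<in> B \<Longrightarrow> scale_op c x \<in> B"
proof -
  have "commutant B \<subseteq> bounded_operators" by (auto simp: commutant_def)
  then show "x \<in> B \<Longrightarrow> scale_op c x \<in> B"
    using commutant_scale[of "commutant B" x c] vn_eq_commutant by simp
qed

lemma vn_scaleR: "x \<in> B \<Longrightarrow> r *\<^sub>R x \<in> B"
  by (simp add: scaleR_eq_scale_op vn_scale)

lemma vn_diff: "x \<in> B \<Longrightarrow> y \<in> B \<Longrightarrow> x - y \<in> B"
  using vn_add[of x "-y"] vn_scale[of y "-1"] by (simp add: uminus_eq_scale_op[symmetric])

lemma vn_zero: "0 \<in> B"
  using vn_diff[OF vn_id vn_id] by simp

lemma vn_sum: "(\<And>i. i \<in> I \<Longrightarrow> f i \<in> B) \<Longrightarrow> (\<Sum>i\<in>I. f i) \<in> B"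
  by (induction I rule: infinite_finite_induct) (auto simp: vn_zero vn_add)

lemma vn_subspace: "subspace B"
  by (simp add: subspace_def vn_zero vn_add vn_scaleR)

end

text \<open>The hull is an intersection. The enclosing algebra \<open>C\<close> keeps the family
  nonempty, so that the intersection consists of complex-linear operators; by monotonicity the
  bicommutant of the intersection lies in every member.\<close>

lemma von_neumann_algebra_hull:
  assumes "von_neumann_algebra C" "S \<subseteq> C"
  shows "von_neumann_algebra (von_neumann_algebra hull S)"
proof -
  let ?H = "von_neumann_algebra hull S"
  have sub: "?H \<subseteq> D" if "von_neumann_algebra D" "S \<subseteq> D" for D
    using that by (auto simp: hull_def)
  have bdd: "?H \<subseteq> bounded_operators"
    using sub[OF assms] assms(1) by (auto simp: von_neumann_algebra_def)
  have adj: "adj x \<in> ?H" if "x \<in> ?H" for x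
    using that vn_adj by (auto simp: hull_def)
  have "commutant (commutant ?H) \<subseteq> D" if D: "von_neumann_algebra D" "S \<subseteq> D" for D
    using commutant_antimono[OF commutant_antimono[OF sub[OF D]]] vn_eq_commutant[OF D(1)] by simp
  then have "commutant (commutant ?H) \<subseteq> ?H"
    by (auto simp: hull_def)
  with bdd adj subset_bicommutant[OF bdd] show ?thesis
    unfolding von_neumann_algebra_def by auto
qed

section \<open>Left and right multiplication on \<open>L\<^sup>2(B, tr)\<close>\<close>

locale L2_algebra =
  fixes B :: "'h::complex_hilbert oper set" and tr :: "'h oper \<Rightarrow> complex"
    and \<eta> :: "'h oper \<Rightarrow> 'k::complex_hilbert"
  assumes vn: "von_neumann_algebra B" and tracial: "tracial_state B tr" and L2: "L2_space B tr \<eta>"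
begin

lemmas B_bounded [simp] = vn_bounded[OF vn]
lemmas B_closed [simp] = vn_adj[OF vn] vn_id[OF vn] vn_add[OF vn] vn_compose[OF vn] vn_scale[OF vn]
  vn_scaleR[OF vn] vn_diff[OF vn] vn_zero[OF vn]
lemmas B_sum = vn_sum[OF vn]

lemma eta_add: "x \<in> B \<Longrightarrow> y \<in> B \<Longrightarrow> \<eta> (x + y) = \<eta> x + \<eta> y"
  and eta_scale: "x \<in> B \<Longrightarrow> \<eta> (scale_op c x) = c *\<^sub>C \<eta> x"
  and cinner_eta: "x \<in> B \<Longrightarrow> y \<in> B \<Longrightarrow> cinner (\<eta> x) (\<eta> y) = tr (adj y o\<^sub>L x)"
  and eta_dense: "closure (\<eta> ` B) = UNIV"
  using L2 by (auto simp: L2_space_def)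

lemma tr_add: "x \<in> B \<Longrightarrow> y \<in> B \<Longrightarrow> tr (x + y) = tr x + tr y"
  and tr_scale: "x \<in> B \<Longrightarrow> tr (scale_op c x) = c * tr x"
  and tr_commute: "x \<in> B \<Longrightarrow> y \<in> B \<Longrightarrow> tr (x o\<^sub>L y) = tr (y o\<^sub>L x)"
  and tr_nonneg: "x \<in> B \<Longrightarrow> op_nonneg x \<Longrightarrow> tr x \<in> \<real>\<^sub>\<ge>\<^sub>0"
  and tr_id: "tr id_blinfun = 1"
  and tr_faithful: "x \<in> B \<Longrightarrow> tr (adj x o\<^sub>L x) = 0 \<Longrightarrow> x = 0"
  using tracial by (auto simp: tracial_state_def positive_trace_def complex_linear_on_def)

lemma tr_zero: "tr 0 = 0"
  using tr_add[of 0 0] by simp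

lemma tr_diff: "x \<in> B \<Longrightarrow> y \<in> B \<Longrightarrow> tr (x - y) = tr x - tr y"
  using tr_add[of x "-y"] tr_scale[of y "-1"] vn_scale[OF vn, of y "-1"]
  by (simp add: uminus_eq_scale_op[symmetric])

lemma tr_sum: "(\<And>i. i \<in> I \<Longrightarrow> f i \<in> B) \<Longrightarrow> tr (\<Sum>i\<in>I. f i) = (\<Sum>i\<in>I. tr (f i))"
  by (induction I rule: infinite_finite_induct) (auto simp: tr_zero tr_add B_sum)

lemma eta_scaleR: "x \<in> B \<Longrightarrow> \<eta> (r *\<^sub>R x) = r *\<^sub>R \<eta> x"
  by (simp add: scaleR_eq_scale_op eta_scale scaleC_of_real)

lemma eta_zero: "\<eta> 0 = 0"
  using eta_add[of 0 0] by simp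

lemma eta_diff: "x \<in> B \<Longrightarrow> y \<in> B \<Longrightarrow> \<eta> (x - y) = \<eta> x - \<eta> y"
  using eta_add[of x "-y"] eta_scale[of y "-1"] vn_scale[OF vn, of y "-1"]
  by (simp add: uminus_eq_scale_op[symmetric] scaleC_minus_one)

lemma eta_sum: "(\<And>i. i \<in> I \<Longrightarrow> f i \<in> B) \<Longrightarrow> \<eta> (\<Sum>i\<in>I. f i) = (\<Sum>i\<in>I. \<eta> (f i))"
  by (induction I rule: infinite_finite_induct) (auto simp: eta_zero eta_add B_sum)

lemma eta_inject:
  assumes "x \<in> B" "y \<in> B" "\<eta> x = \<eta> y"
  shows "x = y"
proof -
  have "tr (adj (x - y) o\<^sub>L (x - y)) = 0"
    using assms by (simp add: cinner_eta[symmetric] eta_diff)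
  then show ?thesis using tr_faithful[of "x - y"] assms by simp
qed

lemma tr_adj: "x \<in> B \<Longrightarrow> tr (adj x) = cnj (tr x)"
  using cinner_commute[of "\<eta> id_blinfun" "\<eta> x"] by (simp add: cinner_eta)

lemma operator_eqI:
  assumes "\<And>x. x \<in> B \<Longrightarrow> blinfun_apply S (\<eta> x) = blinfun_apply T (\<eta> x)"
  shows "S = T"
  by (rule blinfun_eqI, rule continuous_eq_on_dense[OF _ _ eta_dense])
     (use assms in \<open>auto intro: continuous_intros\<close>)


section \<open>Norm estimates and the multiplication operators\<close>

lemma norm_eta: "x \<in> B \<Longrightarrow> complex_of_real ((norm (\<eta> x))\<^sup>2) = tr (adj x o\<^sub>L x)"
  by (simp only: cinner_self[symmetric] cinner_eta)

lemma norm_eta_adj: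
  assumes "x \<in> B"
  shows "norm (\<eta> (adj x)) = norm (\<eta> x)"
proof -
  have "complex_of_real ((norm (\<eta> (adj x)))\<^sup>2) = of_real ((norm (\<eta> x))\<^sup>2)"
    using assms by (simp only: norm_eta B_closed) (simp add: tr_commute)
  then have "(norm (\<eta> (adj x)))\<^sup>2 = (norm (\<eta> x))\<^sup>2" using of_real_eq_iff by blast
  then show ?thesis by (simp add: power2_eq_iff_nonneg)
qed

text \<open>Conjugating the positive operator \<open>(norm b)\<^sup>2 - adj b o\<^sub>L b\<close> by
  \<open>x\<close> keeps it positive, and its trace is the difference of the squares of the two
  sides.\<close>

lemma norm_eta_compose_le:
  assumes b: "b \<in> B" and x: "x \<in> B"
  shows "norm (\<eta> (b o\<^sub>L x)) \<le> norm b * norm (\<eta> x)"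
proof -
  let ?c = "complex_of_real ((norm b)\<^sup>2)"
  define y where "y = adj x o\<^sub>L (scale_op ?c id_blinfun - (adj b o\<^sub>L b)) o\<^sub>L x"
  have "op_nonneg y"
    unfolding y_def using b x by (intro op_nonneg_conjugate op_nonneg_norm_bound) auto
  moreover have yB: "y \<in> B" unfolding y_def using b x by simp
  ultimately have "tr y \<in> \<real>\<^sub>\<ge>\<^sub>0" by (simp add: tr_nonneg)
  moreover have "y = scale_op ?c (adj x o\<^sub>L x) - (adj (b o\<^sub>L x) o\<^sub>L (b o\<^sub>L x))"
    using b x by (simp add: y_def compose_diff_left compose_diff_right adj_compose compose_assoc
        compose_scale_op_left compose_scale_op_right del: of_real_power)
  ultimately have "of_real ((norm b)\<^sup>2 * (norm (\<eta> x))\<^sup>2 - (norm (\<eta> (b o\<^sub>L x)))\<^sup>2) \<in> (\<real>\<^sub>\<ge>\<^sub>0 :: complex set)"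
    using b x by (simp only: tr_diff tr_scale norm_eta B_closed of_real_diff of_real_mult)
  then have "(norm (\<eta> (b o\<^sub>L x)))\<^sup>2 \<le> (norm b * norm (\<eta> x))\<^sup>2"
    by (simp only: nonneg_Reals_of_real_iff power_mult_distrib diff_ge_0_iff_ge)
  then show ?thesis by (rule power2_le_imp_le) simp
qed

text \<open>Taking adjoints is isometric for the L2 norm and turns right multiplication by
  \<open>b\<close> into left multiplication by \<open>adj b\<close>, hence the constant.\<close>

lemma norm_eta_compose_right_le:
  assumes "b \<in> B" "x \<in> B"
  shows "norm (\<eta> (x o\<^sub>L b)) \<le> norm (adj b) * norm (\<eta> x)"
  using norm_eta_compose_le[of "adj b" "adj x"] norm_eta_adj[of "x o\<^sub>L b"] norm_eta_adj[of x] assms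
  by (simp add: adj_compose)

text \<open>Common source of left multiplication, right multiplication and the Jones projection,
  each of which extends a complex-linear map of \<open>B\<close> into itself.\<close>

lemma extend_operator:
  assumes mem: "\<And>x. x \<in> B \<Longrightarrow> \<phi> x \<in> B"
    and add: "\<And>x y. x \<in> B \<Longrightarrow> y \<in> B \<Longrightarrow> \<phi> (x + y) = \<phi> x + \<phi> y"
    and scale: "\<And>c x. x \<in> B \<Longrightarrow> \<phi> (scale_op c x) = scale_op c (\<phi> x)"
    and le: "\<And>x. x \<in> B \<Longrightarrow> norm (\<eta> (\<phi> x)) \<le> K * norm (\<eta> x)"
  shows "\<exists>T\<in>bounded_operators. \<forall>x\<in>B. blinfun_apply T (\<eta> x) = \<eta> (\<phi> x)"
proof -
  obtain T :: "'k oper" where T: "\<And>x. x \<in> B \<Longrightarrow> blinfun_apply T (\<eta> x) = \<eta> (\<phi> x)"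
    using dense_extension[OF vn_subspace[OF vn] eta_add eta_scaleR, of "\<lambda>x. \<eta> (\<phi> x)" K] eta_dense
    by (auto simp: add eta_add mem scale scaleR_eq_scale_op eta_scale scaleC_of_real le)
  have "blinfun_apply T (c *\<^sub>C x) = c *\<^sub>C blinfun_apply T x" for c x
    by (rule continuous_eq_on_dense[OF _ _ eta_dense, of "\<lambda>x. blinfun_apply T (c *\<^sub>C x)" "\<lambda>x. c *\<^sub>C blinfun_apply T x"])
       (auto intro!: continuous_intros simp: eta_scale[symmetric] T scale mem)
  then show ?thesis using T by (auto simp: bounded_operators_def)
qed

lemma operator_the_equality:
  assumes "S \<in> bounded_operators" "\<And>x. x \<in> B \<Longrightarrow> blinfun_apply S (\<eta> x) = \<eta> (\<phi> x)"
  shows "(THE T. T \<in> bounded_operators \<and> (\<forall>x\<in>B. blinfun_apply T (\<eta> x) = \<eta> (\<phi> x))) = S"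
  by (rule the_equality) (use assms in \<open>auto intro: operator_eqI\<close>)

abbreviation L where "L \<equiv> lmult B \<eta>"

lemma lmult_props:
  assumes b: "b \<in> B"
  shows "L b \<in> bounded_operators \<and> (\<forall>x\<in>B. blinfun_apply (L b) (\<eta> x) = \<eta> (b o\<^sub>L x))"
proof -
  obtain T where T: "T \<in> bounded_operators" "\<forall>x\<in>B. blinfun_apply T (\<eta> x) = \<eta> (b o\<^sub>L x)"
    using extend_operator[of "\<lambda>x. b o\<^sub>L x" "norm b"] b
    by (auto simp: compose_add_right compose_scale_op_right norm_eta_compose_le)
  moreover from this have "L b = T" unfolding lmult_def by (intro operator_the_equality) auto
  ultimately show ?thesis by simp
qed

lemma lmult_bounded [simp]: "b \<in> B \<Longrightarrow> L b \<in> bounded_operators"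
  and lmult_eta: "b \<in> B \<Longrightarrow> x \<in> B \<Longrightarrow> blinfun_apply (L b) (\<eta> x) = \<eta> (b o\<^sub>L x)"
  using lmult_props by auto

definition rmult :: "'h oper \<Rightarrow> 'k oper" where
  "rmult b = (THE T. T \<in> bounded_operators \<and> (\<forall>x\<in>B. blinfun_apply T (\<eta> x) = \<eta> (x o\<^sub>L b)))"

lemma rmult_props:
  assumes b: "b \<in> B"
  shows "rmult b \<in> bounded_operators \<and> (\<forall>x\<in>B. blinfun_apply (rmult b) (\<eta> x) = \<eta> (x o\<^sub>L b))"
proof -
  obtain T where T: "T \<in> bounded_operators" "\<forall>x\<in>B. blinfun_apply T (\<eta> x) = \<eta> (x o\<^sub>L b)"
    using extend_operator[of "\<lambda>x. x o\<^sub>L b" "norm (adj b)"] b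
    by (auto simp: compose_add_left compose_scale_op_left norm_eta_compose_right_le)
  moreover from this have "rmult b = T" unfolding rmult_def by (intro operator_the_equality) auto
  ultimately show ?thesis by simp
qed

lemma rmult_bounded [simp]: "b \<in> B \<Longrightarrow> rmult b \<in> bounded_operators"
  and rmult_eta: "b \<in> B \<Longrightarrow> x \<in> B \<Longrightarrow> blinfun_apply (rmult b) (\<eta> x) = \<eta> (x o\<^sub>L b)"
  using rmult_props by auto

lemma adj_eq_on_dense:
  assumes S: "S \<in> bounded_operators"
    and eq: "\<And>x y. x \<in> B \<Longrightarrow> y \<in> B \<Longrightarrow>
      cinner (blinfun_apply T (\<eta> x)) (\<eta> y) = cinner (\<eta> x) (blinfun_apply S (\<eta> y))"
  shows "adj T = S"
proof (rule adj_eqI[OF S])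
  fix u v
  have 1: "cinner (blinfun_apply T u) (\<eta> y) = cinner u (blinfun_apply S (\<eta> y))" if "y \<in> B" for u y
    by (rule continuous_eq_on_dense[OF _ _ eta_dense, of "\<lambda>u. cinner (blinfun_apply T u) (\<eta> y)"
          "\<lambda>u. cinner u (blinfun_apply S (\<eta> y))"])
       (use that in \<open>auto intro!: continuous_intros simp: eq\<close>)
  show "cinner (blinfun_apply T u) v = cinner u (blinfun_apply S v)"
    by (rule continuous_eq_on_dense[OF _ _ eta_dense, of "\<lambda>v. cinner (blinfun_apply T u) v"
          "\<lambda>v. cinner u (blinfun_apply S v)"])
       (auto intro!: continuous_intros simp: 1)
qed

lemma adj_lmult: "b \<in> B \<Longrightarrow> adj (L b) = L (adj b)"
  by (rule adj_eq_on_dense) (auto simp: lmult_eta cinner_eta adj_compose compose_assoc)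

text \<open>In contrast to \<open>adj_lmult\<close> this rests on traciality: \<open>b\<close> has
  to be moved from the right end of a product to its left end.\<close>

lemma adj_rmult:
  assumes b: "b \<in> B"
  shows "adj (rmult b) = rmult (adj b)"
proof (rule adj_eq_on_dense)
  fix x y assume xy: "x \<in> B" "y \<in> B"
  have "tr (adj y o\<^sub>L x o\<^sub>L b) = tr (b o\<^sub>L (adj y o\<^sub>L x))"
    using b xy by (simp add: tr_commute[of "adj y o\<^sub>L x" b])
  then show "cinner (blinfun_apply (rmult b) (\<eta> x)) (\<eta> y) = cinner (\<eta> x) (blinfun_apply (rmult (adj b)) (\<eta> y))"
    using b xy by (simp add: rmult_eta cinner_eta adj_compose compose_assoc)
qed (use b in simp)

lemma lmult_compose: "a \<in> B \<Longrightarrow> b \<in> B \<Longrightarrow> L a o\<^sub>L L b = L (a o\<^sub>L b)"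
  by (rule operator_eqI) (simp add: lmult_eta compose_assoc)

lemma lmult_rmult: "a \<in> B \<Longrightarrow> b \<in> B \<Longrightarrow> L a o\<^sub>L rmult b = rmult b o\<^sub>L L a"
  by (rule operator_eqI) (simp add: lmult_eta rmult_eta compose_assoc)

lemma lmult_id: "L id_blinfun = id_blinfun"
  by (rule operator_eqI) (simp add: lmult_eta)

text \<open>The modular conjugation \<open>x \<mapsto> x\<^sup>*\<close>, an antiunitary and hence only real-linear map.\<close>

definition J :: "'k oper" where
  "J = (SOME T. \<forall>x\<in>B. blinfun_apply T (\<eta> x) = \<eta> (adj x))"

lemma J_eta: "x \<in> B \<Longrightarrow> blinfun_apply J (\<eta> x) = \<eta> (adj x)"
proof -
  have "\<exists>T :: 'k oper. \<forall>x\<in>B. blinfun_apply T (\<eta> x) = \<eta> (adj x)"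
    by (rule dense_extension[OF vn_subspace[OF vn] eta_add eta_scaleR, where K = 1])
       (auto simp: eta_dense adj_add eta_add scaleR_eq_scale_op adj_scale eta_scale scaleC_of_real norm_eta_adj)
  from someI_ex[OF this] show "x \<in> B \<Longrightarrow> blinfun_apply J (\<eta> x) = \<eta> (adj x)"
    by (simp add: J_def)
qed

text \<open>This symmetry is the form that antiunitarity takes for an involution. On the image of
  \<open>B\<close> it is traciality,
  \<open>tr (adj y o\<^sub>L adj x) = tr (adj x o\<^sub>L adj y)\<close>; density extends it first
  in \<open>u\<close>, then in \<open>v\<close>.\<close>

lemma cinner_J: "cinner (blinfun_apply J u) v = cinner (blinfun_apply J v) u"
proof -
  have 1: "cinner (blinfun_apply J u) (\<eta> y) = cinner (blinfun_apply J (\<eta> y)) u" if y: "y \<in> B" for u y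
    by (rule continuous_eq_on_dense[OF _ _ eta_dense, of "\<lambda>u. cinner (blinfun_apply J u) (\<eta> y)"
          "\<lambda>u. cinner (blinfun_apply J (\<eta> y)) u"])
       (use y in \<open>auto intro!: continuous_intros tr_commute simp: J_eta cinner_eta\<close>)
  show ?thesis
    by (rule continuous_eq_on_dense[OF _ _ eta_dense, of "\<lambda>v. cinner (blinfun_apply J u) v"
          "\<lambda>v. cinner (blinfun_apply J v) u"])
       (auto intro!: continuous_intros simp: 1)
qed

lemma J_J: "blinfun_apply J (blinfun_apply J u) = u"
  by (rule continuous_eq_on_dense[OF _ _ eta_dense, of "\<lambda>u. blinfun_apply J (blinfun_apply J u)" "\<lambda>u. u"])
     (auto intro!: continuous_intros simp: J_eta)

lemma cinner_J_J: "cinner (blinfun_apply J u) (blinfun_apply J v) = cinner v u"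
  using cinner_J[of u "blinfun_apply J v"] by (simp add: J_J)

end

section \<open>The Jones projection and the trace on the basic construction\<close>

locale expectation = L2_algebra B tr \<eta>
  for B :: "'h::complex_hilbert oper set" and tr and \<eta> :: "'h oper \<Rightarrow> 'k::complex_hilbert" +
  fixes A and E
  assumes vnA: "von_neumann_algebra A" and A_subset: "A \<subseteq> B"
    and expectation: "conditional_expectation A B tr E"
begin

lemma A_B [simp]: "a \<in> A \<Longrightarrow> a \<in> B"
  using A_subset by auto

lemma A_adj [simp]: "a \<in> A \<Longrightarrow> adj a \<in> A"
  by (rule vn_adj[OF vnA])

lemma E_A [simp]: "x \<in> B \<Longrightarrow> E x \<in> A"
  and E_fix: "a \<in> A \<Longrightarrow> E a = a"
  and E_add: "x \<in> B \<Longrightarrow> y \<in> B \<Longrightarrow> E (x + y) = E x + E y"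
  and E_scale: "x \<in> B \<Longrightarrow> E (scale_op c x) = scale_op c (E x)"
  and E_bimodule: "a \<in> A \<Longrightarrow> b \<in> A \<Longrightarrow> x \<in> B \<Longrightarrow> E (a o\<^sub>L x o\<^sub>L b) = a o\<^sub>L E x o\<^sub>L b"
  and tr_E: "x \<in> B \<Longrightarrow> tr (E x) = tr x"
  using expectation by (auto simp: conditional_expectation_def)

lemma E_left: "a \<in> A \<Longrightarrow> x \<in> B \<Longrightarrow> E (a o\<^sub>L x) = a o\<^sub>L E x"
  using E_bimodule[of a id_blinfun x] vn_id[OF vnA] by simp

lemma E_right: "b \<in> A \<Longrightarrow> x \<in> B \<Longrightarrow> E (x o\<^sub>L b) = E x o\<^sub>L b"
  using E_bimodule[of id_blinfun b x] vn_id[OF vnA] by simp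

lemma E_zero: "E 0 = 0"
  using E_add[of 0 0] by simp

lemma E_diff: "x \<in> B \<Longrightarrow> y \<in> B \<Longrightarrow> E (x - y) = E x - E y"
  using E_add[of x "-y"] E_scale[of y "-1"] vn_scale[OF vn, of y "-1"]
  by (simp add: uminus_eq_scale_op[symmetric])

lemma E_sum: "(\<And>i. i \<in> I \<Longrightarrow> f i \<in> B) \<Longrightarrow> E (\<Sum>i\<in>I. f i) = (\<Sum>i\<in>I. E (f i))"
  by (induction I rule: infinite_finite_induct) (auto simp: E_zero E_add B_sum)

text \<open>The difference \<open>d\<close> of the two sides lies in \<open>A\<close>. Trace
  preservation and the bimodule property give both sides the same inner product with
  \<open>d\<close>, so \<open>d\<close> is orthogonal to itself and vanishes by
  faithfulness.\<close>

lemma E_adj: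
  assumes x: "x \<in> B"
  shows "E (adj x) = adj (E x)"
proof -
  define d where "d = E (adj x) - adj (E x)"
  have dA: "d \<in> A" unfolding d_def using x by (intro vn_diff[OF vnA]) auto
  have "tr (adj d o\<^sub>L E (adj x)) = tr (adj d o\<^sub>L adj x)"
    using x dA tr_E[of "adj d o\<^sub>L adj x"] by (simp add: E_left)
  also have "\<dots> = cnj (tr (x o\<^sub>L d))"
    using x dA tr_adj[of "x o\<^sub>L d"] by (simp add: adj_compose)
  also have "\<dots> = cnj (tr (E x o\<^sub>L d))"
    using x dA tr_E[of "x o\<^sub>L d"] by (simp add: E_right)
  also have "\<dots> = tr (adj d o\<^sub>L adj (E x))"
    using x dA tr_adj[of "E x o\<^sub>L d"] by (simp add: adj_compose)
  finally have "tr (adj d o\<^sub>L d) = 0"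
    using x dA by (subst (2) d_def) (simp add: compose_diff_right tr_diff)
  then show ?thesis using tr_faithful[of d] dA by (simp add: d_def)
qed

text \<open>Because \<open>E\<close> acts as an orthogonal projection, the squared norm of
  \<open>\<eta> (E x)\<close> equals the inner product of \<open>\<eta> x\<close> with
  \<open>\<eta> (E x)\<close>; Cauchy-Schwarz then finishes.\<close>

lemma norm_eta_E_le:
  assumes x: "x \<in> B"
  shows "norm (\<eta> (E x)) \<le> norm (\<eta> x)"
proof -
  have "tr (adj (E x) o\<^sub>L E x) = tr (adj (E x) o\<^sub>L x)"
    using x tr_E[of "adj (E x) o\<^sub>L x"] by (simp add: E_left)
  then have "complex_of_real ((norm (\<eta> (E x)))\<^sup>2) = cinner (\<eta> x) (\<eta> (E x))"
    using x by (simp only: norm_eta cinner_eta A_B E_A)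
  then have "(norm (\<eta> (E x)))\<^sup>2 = \<eta> x \<bullet> \<eta> (E x)"
    by (metis Re_cinner Re_complex_of_real)
  also have "\<dots> \<le> norm (\<eta> x) * norm (\<eta> (E x))" by (rule norm_cauchy_schwarz)
  finally show ?thesis by (cases "\<eta> (E x) = 0") (simp_all add: power2_eq_square)
qed

section \<open>The Jones projection\<close>

abbreviation e where "e \<equiv> jones_projection A \<eta>"

lemma jones_props: "e \<in> bounded_operators \<and> (\<forall>x\<in>B. blinfun_apply e (\<eta> x) = \<eta> (E x))"
proof -
  let ?S = "closure (\<eta> ` A)"
  obtain T where T: "T \<in> bounded_operators" "\<And>x. x \<in> B \<Longrightarrow> blinfun_apply T (\<eta> x) = \<eta> (E x)"
    using extend_operator[of E 1] by (auto simp: E_add E_scale norm_eta_E_le)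
  have range: "blinfun_apply T u \<in> ?S" for u
  proof -
    have "closed (blinfun_apply T -` ?S)"
      by (intro continuous_closed_vimage) (auto intro: continuous_intros)
    then have "closure (\<eta> ` B) \<subseteq> blinfun_apply T -` ?S"
      by (intro closure_minimal) (auto simp: T intro!: subsetD[OF closure_subset])
    then show ?thesis using eta_dense by auto
  qed
  have orth1: "cinner (u - blinfun_apply T u) (\<eta> a) = 0" if a: "a \<in> A" for u a
  proof (rule continuous_eq_on_dense[OF _ _ eta_dense, of "\<lambda>u. cinner (u - blinfun_apply T u) (\<eta> a)" "\<lambda>_. 0"])
    fix u assume "u \<in> \<eta> ` B"
    then obtain x where x: "x \<in> B" "u = \<eta> x" by auto
    have "tr (adj a o\<^sub>L E x) = tr (adj a o\<^sub>L x)"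
      using x a tr_E[of "adj a o\<^sub>L x"] by (simp add: E_left)
    then show "cinner (u - blinfun_apply T u) (\<eta> a) = 0"
      using x a by (simp add: T cinner_diff_left cinner_eta)
  qed (auto intro!: continuous_intros)
  have orth: "cinner (u - blinfun_apply T u) y = 0" if "y \<in> ?S" for u y
  proof -
    have "closed {y. cinner (u - blinfun_apply T u) y = 0}"
      by (intro closed_Collect_eq continuous_intros)
    then have "?S \<subseteq> {y. cinner (u - blinfun_apply T u) y = 0}"
      by (intro closure_minimal) (auto simp: orth1)
    then show ?thesis using that by auto
  qed
  have "e = T"
    unfolding jones_projection_def proj_onto_def
  proof (rule the_equality)
    fix p assume p: "p \<in> bounded_operators \<and>
      (\<forall>x. blinfun_apply p x \<in> ?S \<and> (\<forall>y\<in>?S. cinner (x - blinfun_apply p x) y = 0))"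
    show "p = T"
    proof (rule blinfun_eqI)
      fix u
      \<comment> \<open>As a difference of two residuals \<open>?d\<close> is orthogonal to the
        subspace, and as a difference of two of its points it is orthogonal to itself.\<close>
      let ?d = "blinfun_apply p u - blinfun_apply T u"
      have "cinner ?d y = 0" if "y \<in> ?S" for y
      proof -
        have "?d = (u - blinfun_apply T u) - (u - blinfun_apply p u)" by simp
        then show ?thesis
          using that orth p by (simp only: cinner_diff_left[of "u - _"]) simp
      qed
      from this[of "blinfun_apply p u"] this[of "blinfun_apply T u"] range p
      have "cinner ?d ?d = 0" by (simp add: cinner_diff_right)
      then show "blinfun_apply p u = blinfun_apply T u" by (simp add: cinner_self)
    qed
  qed (use T(1) range orth in blast)
  then show ?thesis using T by simp
qed

lemma jones_bounded [simp]: "e \<in> bounded_operators"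
  and jones_eta: "x \<in> B \<Longrightarrow> blinfun_apply e (\<eta> x) = \<eta> (E x)"
  using jones_props by auto

lemma adj_jones: "adj e = e"
proof (rule adj_eq_on_dense)
  fix x y assume xy: "x \<in> B" "y \<in> B"
  have "tr (adj y o\<^sub>L E x) = tr (E (adj y o\<^sub>L E x))" using xy by (simp add: tr_E)
  also have "\<dots> = tr (E (adj (E y) o\<^sub>L x))" using xy by (simp add: E_left E_right E_adj)
  also have "\<dots> = tr (adj (E y) o\<^sub>L x)" using xy by (simp add: tr_E)
  finally show "cinner (blinfun_apply e (\<eta> x)) (\<eta> y) = cinner (\<eta> x) (blinfun_apply e (\<eta> y))"
    using xy by (simp add: jones_eta cinner_eta)
qed simp

lemma jones_idem: "e o\<^sub>L e = e"
  by (rule operator_eqI) (simp add: jones_eta E_fix)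

lemma jones_rmult: "a \<in> A \<Longrightarrow> e o\<^sub>L rmult a = rmult a o\<^sub>L e"
  by (rule operator_eqI) (simp add: jones_eta rmult_eta E_right)

lemma cinner_jones: "cinner (blinfun_apply e u) v = cinner u (blinfun_apply e v)"
  using cinner_adj[OF jones_bounded] by (simp add: adj_jones)

lemma cinner_lmult: "b \<in> B \<Longrightarrow> cinner (blinfun_apply (L b) u) v = cinner u (blinfun_apply (L (adj b)) v)"
  by (simp add: cinner_adj adj_lmult)

section \<open>The commutant of the right action and the basic construction\<close>

abbreviation right_commutant where "right_commutant \<equiv> commutant (rmult ` A)"

lemma vn_right_commutant: "von_neumann_algebra right_commutant"
  by (rule von_neumann_algebra_commutant) (auto simp: adj_rmult)

lemma generators_right_commutant: "insert e (L ` B) \<subseteq> right_commutant"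
  by (auto simp: commutant_def jones_rmult lmult_rmult)

abbreviation B\<^sub>1 where "B\<^sub>1 \<equiv> basic_construction A B \<eta>"

lemma vn_basic_construction: "von_neumann_algebra B\<^sub>1"
  unfolding basic_construction_def
  by (rule von_neumann_algebra_hull[OF vn_right_commutant generators_right_commutant])

text \<open>The basic construction is given only as the smallest von Neumann algebra over its
  generators. This inclusion supplies the property of its elements on which the trace computation
  rests: they commute with the right action of \<open>A\<close>.\<close>

lemma basic_construction_subset: "B\<^sub>1 \<subseteq> right_commutant"
  unfolding basic_construction_def using vn_right_commutant generators_right_commutant
  by (intro hull_minimal)

lemma jones_basic [simp]: "e \<in> B\<^sub>1"
  unfolding basic_construction_def by (rule hull_inc) simp

lemma lmult_basic [simp]: "x \<in> B \<Longrightarrow> L x \<in> B\<^sub>1"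
  unfolding basic_construction_def by (rule hull_inc) simp

lemmas basic_closed = vn_adj[OF vn_basic_construction] vn_id[OF vn_basic_construction]
  vn_compose[OF vn_basic_construction] vn_diff[OF vn_basic_construction]
  vn_scale[OF vn_basic_construction] vn_sum[OF vn_basic_construction]

section \<open>Frame operators and the expansion condition\<close>

definition frame_op :: "'i set \<Rightarrow> ('i \<Rightarrow> 'h oper) \<Rightarrow> 'k oper" where
  "frame_op I lam = (\<Sum>i\<in>I. L (adj (lam i)) o\<^sub>L e o\<^sub>L L (lam i))"

lemma basis_projection_condition_iff_frame_op:
  "basis_projection_condition A B \<eta> I lam \<longleftrightarrow> frame_op I lam = id_blinfun"
  by (simp add: basis_projection_condition_def frame_op_def)

text \<open>On the level of the algebra this is the frame operator of the family
  \<open>adj (lam i)\<close>, with \<open>B\<close> viewed as a right \<open>A\<close>-module with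
  inner product \<open>E (adj x o\<^sub>L y)\<close>.\<close>

lemma frame_op_eta:
  assumes "\<And>i. i \<in> I \<Longrightarrow> lam i \<in> B" "x \<in> B"
  shows "blinfun_apply (frame_op I lam) (\<eta> x) = \<eta> (\<Sum>i\<in>I. adj (lam i) o\<^sub>L E (lam i o\<^sub>L x))"
  using assms by (simp add: frame_op_def blinfun.sum_left lmult_eta jones_eta eta_sum)

text \<open>Substituting \<open>adj x\<close> for \<open>x\<close> and taking adjoints exchanges the
  left and right forms; the left form of the coefficients is the one produced by
  \<open>frame_op\<close>.\<close>

lemma basis_expansion_condition_iff_adjoint:
  assumes lam: "\<And>i. i \<in> I \<Longrightarrow> lam i \<in> B"
  shows "basis_expansion_condition B E I lam \<longleftrightarrow>
    (\<forall>x\<in>B. x = (\<Sum>i\<in>I. adj (lam i) o\<^sub>L E (lam i o\<^sub>L x)))"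
proof -
  have *: "adj (\<Sum>i\<in>I. E (x o\<^sub>L adj (lam i)) o\<^sub>L lam i) =
      (\<Sum>i\<in>I. adj (lam i) o\<^sub>L E (lam i o\<^sub>L adj x))" if "x \<in> B" for x
    using that lam by (subst adj_sum) (auto intro!: sum.cong simp: adj_compose E_adj[symmetric])
  have S: "(\<Sum>i\<in>I. E (x o\<^sub>L adj (lam i)) o\<^sub>L lam i) \<in> B" if "x \<in> B" for x
    using that lam by (intro B_sum) auto
  show ?thesis
    unfolding basis_expansion_condition_def
  proof (intro iffI ballI)
    fix x assume h: "\<forall>x\<in>B. x = (\<Sum>i\<in>I. E (x o\<^sub>L adj (lam i)) o\<^sub>L lam i)" and x: "x \<in> B"
    show "x = (\<Sum>i\<in>I. adj (lam i) o\<^sub>L E (lam i o\<^sub>L x))"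
      using *[of "adj x"] h[rule_format, of "adj x"] x by simp
  next
    fix x assume h: "\<forall>x\<in>B. x = (\<Sum>i\<in>I. adj (lam i) o\<^sub>L E (lam i o\<^sub>L x))" and x: "x \<in> B"
    have "adj (adj x) = adj (adj (\<Sum>i\<in>I. E (x o\<^sub>L adj (lam i)) o\<^sub>L lam i))"
      using *[OF x] h[rule_format, of "adj x"] x by simp
    then show "x = (\<Sum>i\<in>I. E (x o\<^sub>L adj (lam i)) o\<^sub>L lam i)"
      using x S[OF x] by simp
  qed
qed

lemma basis_projection_condition_iff_expansion:
  assumes lam: "\<And>i. i \<in> I \<Longrightarrow> lam i \<in> B"
  shows "basis_projection_condition A B \<eta> I lam \<longleftrightarrow> basis_expansion_condition B E I lam"
proof -
  have S: "(\<Sum>i\<in>I. adj (lam i) o\<^sub>L E (lam i o\<^sub>L x)) \<in> B" if "x \<in> B" for x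
    using that lam by (intro B_sum) auto
  have eq: "blinfun_apply (frame_op I lam) (\<eta> x) = \<eta> x \<longleftrightarrow>
      x = (\<Sum>i\<in>I. adj (lam i) o\<^sub>L E (lam i o\<^sub>L x))" if "x \<in> B" for x
    using frame_op_eta[of I lam x] lam that eta_inject[OF that S[OF that]] by (metis (no_types, lifting))
  have "frame_op I lam = id_blinfun \<longleftrightarrow> (\<forall>x\<in>B. blinfun_apply (frame_op I lam) (\<eta> x) = \<eta> x)"
    by (auto intro: operator_eqI)
  also have "\<dots> \<longleftrightarrow> (\<forall>x\<in>B. x = (\<Sum>i\<in>I. adj (lam i) o\<^sub>L E (lam i o\<^sub>L x)))"
    using eq by (rule ball_cong[OF refl])
  finally show ?thesis
    by (simp add: basis_expansion_condition_iff_adjoint[OF lam] basis_projection_condition_iff_frame_op)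
qed

text \<open>With \<open>\<xi>\<^sub>k = \<eta> (\<nu>\<^sub>k\<^sup>*)\<close>, the functional \<open>T \<mapsto> \<tau> \<Sum>\<^sub>k \<langle>T \<xi>\<^sub>k, \<xi>\<^sub>k\<rangle>\<close> is a trace on the commutant of the
  right action of \<open>A\<close>: inserting \<open>1 = \<Sum>\<^sub>l \<nu>\<^sub>l\<^sup>* e \<nu>\<^sub>l\<close> reduces this to the fact that \<open>J\<close> intertwines
  \<open>e \<nu>\<^sub>l T \<xi>\<^sub>k\<close> and \<open>e \<nu>\<^sub>k T\<^sup>* \<xi>\<^sub>l\<close>.\<close>

lemma J_compression:
  assumes T: "T \<in> right_commutant" and a: "a \<in> B" and b: "b \<in> B"
  shows "blinfun_apply J (blinfun_apply e (blinfun_apply (L b) (blinfun_apply T (\<eta> (adj a))))) =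
    blinfun_apply e (blinfun_apply (L a) (blinfun_apply (adj T) (\<eta> (adj b))))"
    (is "?l = ?r")
proof (rule cinner_eqI)
  have Tb: "T \<in> bounded_operators" using T by (simp add: commutant_def)
  have Tcomm: "blinfun_apply T (blinfun_apply (rmult n) u) = blinfun_apply (rmult n) (blinfun_apply T u)"
    if "n \<in> A" for n u
  proof -
    have "T o\<^sub>L rmult n = rmult n o\<^sub>L T" using T that by (simp add: commutant_def)
    from arg_cong[OF this, of "\<lambda>S. blinfun_apply S u"] show ?thesis by simp
  qed
  fix w
  show "cinner ?l w = cinner ?r w"
  proof (rule continuous_eq_on_dense[OF _ _ eta_dense, of "\<lambda>w. cinner ?l w" "\<lambda>w. cinner ?r w"])
    fix w assume "w \<in> \<eta> ` B"
    then obtain y where y: "y \<in> B" "w = \<eta> y" by auto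
    \<comment> \<open>Only \<open>n = E y\<close> survives under \<open>e\<close>. Reading
      \<open>adj a o\<^sub>L n\<close> as a right multiple lets \<open>n\<close> pass through
      \<open>T\<close>; moved across the inner product it becomes \<open>adj n = E (adj y)\<close>,
      which is what \<open>J\<close> makes of \<open>y\<close> on the other side.\<close>
    define n where "n = E y"
    have n: "n \<in> A" using y by (simp add: n_def)
    have "cinner ?r w = cinner (blinfun_apply (adj T) (\<eta> (adj b))) (\<eta> (adj a o\<^sub>L n))"
      using y a b n by (simp add: cinner_jones cinner_lmult jones_eta n_def[symmetric] lmult_eta)
    also have "\<dots> = cinner (\<eta> (adj b)) (blinfun_apply T (blinfun_apply (rmult n) (\<eta> (adj a))))"
      using a n Tb by (simp add: cinner_adj_left rmult_eta)
    also have "\<dots> = cinner (blinfun_apply (rmult (adj n)) (\<eta> (adj b))) (blinfun_apply T (\<eta> (adj a)))"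
      using n by (simp add: Tcomm adj_rmult[symmetric] cinner_adj_left)
    also have "\<dots> = cinner (blinfun_apply (L (adj b)) (\<eta> (adj n))) (blinfun_apply T (\<eta> (adj a)))"
      using n b by (simp add: rmult_eta lmult_eta)
    also have "\<dots> = cinner (blinfun_apply e (\<eta> (adj y))) (blinfun_apply (L b) (blinfun_apply T (\<eta> (adj a))))"
      using n b y by (simp add: cinner_lmult jones_eta E_adj n_def)
    also have "\<dots> = cinner ?l w"
      using y by (simp add: cinner_J[of _ "\<eta> y"] J_eta cinner_jones)
    finally show "cinner ?l w = cinner ?r w" by simp
  qed (auto intro!: continuous_intros)
qed

lemma frame_trace_commute:
  assumes nu: "\<And>k. k \<in> I \<Longrightarrow> nu k \<in> B" and frame: "frame_op I nu = id_blinfun"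
    and S: "S \<in> right_commutant" and T: "T \<in> right_commutant"
  shows "(\<Sum>k\<in>I. cinner (blinfun_apply (S o\<^sub>L T) (\<eta> (adj (nu k)))) (\<eta> (adj (nu k)))) =
    (\<Sum>k\<in>I. cinner (blinfun_apply (T o\<^sub>L S) (\<eta> (adj (nu k)))) (\<eta> (adj (nu k))))"
proof -
  define v where "v T k l = blinfun_apply e (blinfun_apply (L (nu l)) (blinfun_apply T (\<eta> (adj (nu k)))))"
    for T k l
  have insert_frame: "cinner u w = (\<Sum>l\<in>I. cinner (blinfun_apply e (blinfun_apply (L (nu l)) u))
      (blinfun_apply e (blinfun_apply (L (nu l)) w)))" for u w
  proof -
    have ee: "blinfun_apply e (blinfun_apply e u) = blinfun_apply e u" for u
      using arg_cong[OF jones_idem, of "\<lambda>S. blinfun_apply S u"] by simp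
    have "cinner u w = cinner u (blinfun_apply (frame_op I nu) w)" by (simp add: frame)
    also have "\<dots> = (\<Sum>l\<in>I. cinner (blinfun_apply e (blinfun_apply (L (nu l)) u))
      (blinfun_apply e (blinfun_apply (L (nu l)) w)))"
      using nu by (simp add: frame_op_def blinfun.sum_left cinner_sum_right cinner_lmult cinner_jones ee)
    finally show ?thesis .
  qed
  have expand: "(\<Sum>k\<in>I. cinner (blinfun_apply (S o\<^sub>L T) (\<eta> (adj (nu k)))) (\<eta> (adj (nu k)))) =
      (\<Sum>k\<in>I. \<Sum>l\<in>I. cinner (v T k l) (v (adj S) k l))" if "S \<in> right_commutant" for S T
  proof (intro sum.cong refl)
    fix k
    have "S \<in> bounded_operators" using that by (simp add: commutant_def)
    then have "cinner (blinfun_apply (S o\<^sub>L T) (\<eta> (adj (nu k)))) (\<eta> (adj (nu k))) =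
        cinner (blinfun_apply T (\<eta> (adj (nu k)))) (blinfun_apply (adj S) (\<eta> (adj (nu k))))"
      by (simp add: cinner_adj)
    also have "\<dots> = (\<Sum>l\<in>I. cinner (v T k l) (v (adj S) k l))"
      unfolding v_def by (rule insert_frame)
    finally show "cinner (blinfun_apply (S o\<^sub>L T) (\<eta> (adj (nu k)))) (\<eta> (adj (nu k))) =
      (\<Sum>l\<in>I. cinner (v T k l) (v (adj S) k l))" .
  qed
  have "adj S \<in> right_commutant" using S by (rule vn_adj[OF vn_right_commutant])
  then have J: "blinfun_apply J (v T k l) = v (adj T) l k" "blinfun_apply J (v (adj S) k l) = v S l k"
    if "k \<in> I" "l \<in> I" for k l
    using that S T nu vn_bounded[OF vn_right_commutant S]
    by (simp_all add: v_def J_compression)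
  \<comment> \<open>Antiunitarity of \<open>J\<close> swaps the two arguments, and \<open>J\<close>
    itself swaps \<open>k\<close> with \<open>l\<close> and toggles the adjoints, so the roles of
    \<open>S\<close> and \<open>T\<close> are exchanged.\<close>
  have "(\<Sum>k\<in>I. \<Sum>l\<in>I. cinner (v T k l) (v (adj S) k l)) = (\<Sum>k\<in>I. \<Sum>l\<in>I. cinner (v S l k) (v (adj T) l k))"
    by (intro sum.cong refl) (simp add: J[symmetric] cinner_J_J)
  also have "\<dots> = (\<Sum>k\<in>I. \<Sum>l\<in>I. cinner (v S k l) (v (adj T) k l))" by (rule sum.swap)
  finally show ?thesis using expand S T by simp
qed

text \<open>The normalisation makes \<open>Tr\<close> extend \<open>tr\<close>, the expansion of the
  identity gives the Markov property, and the frame identity gives the trace property.\<close>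

lemma markov_trace_of_basis:
  assumes nu: "\<And>k. k \<in> I \<Longrightarrow> nu k \<in> B" and expansion: "basis_expansion_condition B E I nu"
    and \<tau>: "\<tau> > 0" and sum: "scale_op (of_real \<tau>) (\<Sum>k\<in>I. adj (nu k) o\<^sub>L nu k) = id_blinfun"
  shows "markov_trace A B tr \<eta> \<tau>"
proof -
  have frame: "frame_op I nu = id_blinfun"
    using expansion basis_projection_condition_iff_expansion[of I nu] nu
    by (simp add: basis_projection_condition_iff_frame_op)
  define Tr where "Tr T = of_real \<tau> * (\<Sum>k\<in>I. cinner (blinfun_apply T (\<eta> (adj (nu k)))) (\<eta> (adj (nu k))))"
    for T
  have Tr: "Tr (L x) = tr x" if x: "x \<in> B" for x
  proof -
    have "Tr (L x) = of_real \<tau> * (\<Sum>k\<in>I. tr (x o\<^sub>L (adj (nu k) o\<^sub>L nu k)))"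
      using nu x by (auto intro!: sum.cong simp: Tr_def lmult_eta cinner_eta tr_commute[of "nu _"] compose_assoc)
    also have "\<dots> = tr (x o\<^sub>L scale_op (of_real \<tau>) (\<Sum>k\<in>I. adj (nu k) o\<^sub>L nu k))"
      using nu x by (simp add: compose_scale_op_right compose_sum_right tr_scale tr_sum B_sum)
    finally show ?thesis by (simp add: sum)
  qed
  have Tre: "Tr (L x o\<^sub>L e) = of_real \<tau> * tr x" if x: "x \<in> B" for x
  proof -
    have "Tr (L x o\<^sub>L e) = of_real \<tau> * (\<Sum>k\<in>I. tr (x o\<^sub>L (E (adj (nu k)) o\<^sub>L nu k)))"
      using nu x by (auto intro!: sum.cong simp: Tr_def lmult_eta jones_eta cinner_eta tr_commute[of "nu _"] compose_assoc)
    also have "(\<Sum>k\<in>I. tr (x o\<^sub>L (E (adj (nu k)) o\<^sub>L nu k))) = tr (x o\<^sub>L (\<Sum>k\<in>I. E (adj (nu k)) o\<^sub>L nu k))"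
      using nu x by (simp add: compose_sum_right tr_sum)
    also have "(\<Sum>k\<in>I. E (adj (nu k)) o\<^sub>L nu k) = id_blinfun"
      using bspec[OF expansion[unfolded basis_expansion_condition_def] B_closed(2)] by simp
    finally show ?thesis by simp
  qed
  have "positive_trace B\<^sub>1 Tr"
    unfolding positive_trace_def complex_linear_on_def
  proof (intro conjI ballI allI impI)
    fix x y assume "x \<in> B\<^sub>1" "y \<in> B\<^sub>1"
    then have "x \<in> right_commutant" "y \<in> right_commutant"
      using basic_construction_subset by auto
    then show "Tr (x o\<^sub>L y) = Tr (y o\<^sub>L x)"
      unfolding Tr_def using frame_trace_commute[of I nu x y] nu frame by simp
  next
    fix x :: "'k oper" assume x: "op_nonneg x"
    have "(\<Sum>k\<in>I. cinner (blinfun_apply x (\<eta> (adj (nu k)))) (\<eta> (adj (nu k)))) \<in> \<real>\<^sub>\<ge>\<^sub>0"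
      using x by (induction I rule: infinite_finite_induct) (auto simp: op_nonneg_def intro: nonneg_Reals_add_I)
    then show "Tr x \<in> \<real>\<^sub>\<ge>\<^sub>0"
      unfolding Tr_def using \<tau> by (intro nonneg_Reals_mult_I) auto
  qed (auto simp: Tr_def blinfun.add_left cinner_add_left sum.distrib ring_distribs cinner_scaleC_left
      sum_distrib_left mult_ac)
  then show ?thesis
    unfolding markov_trace_def using tracial \<tau> Tr Tre by blast
qed

end

section \<open>Consequences of the Markov property\<close>

locale markov = expectation B tr \<eta> A E
  for B :: "'h::complex_hilbert oper set" and tr and \<eta> :: "'h oper \<Rightarrow> 'k::complex_hilbert" and A and E +
  fixes \<tau> :: real and Tr :: "'k oper \<Rightarrow> complex"
  assumes tau_pos: "\<tau> > 0"
    and Tr_positive: "positive_trace (basic_construction A B \<eta>) Tr"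
    and Tr_lmult: "x \<in> B \<Longrightarrow> Tr (lmult B \<eta> x) = tr x"
    and Tr_lmult_jones: "x \<in> B \<Longrightarrow> Tr (lmult B \<eta> x o\<^sub>L jones_projection A \<eta>) = of_real \<tau> * tr x"
begin

lemma Tr_add: "x \<in> B\<^sub>1 \<Longrightarrow> y \<in> B\<^sub>1 \<Longrightarrow> Tr (x + y) = Tr x + Tr y"
  and Tr_scale: "x \<in> B\<^sub>1 \<Longrightarrow> Tr (scale_op c x) = c * Tr x"
  and Tr_commute: "x \<in> B\<^sub>1 \<Longrightarrow> y \<in> B\<^sub>1 \<Longrightarrow> Tr (x o\<^sub>L y) = Tr (y o\<^sub>L x)"
  and Tr_nonneg: "x \<in> B\<^sub>1 \<Longrightarrow> op_nonneg x \<Longrightarrow> Tr x \<in> \<real>\<^sub>\<ge>\<^sub>0"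
  using Tr_positive by (auto simp: positive_trace_def complex_linear_on_def)

lemma Tr_diff: "x \<in> B\<^sub>1 \<Longrightarrow> y \<in> B\<^sub>1 \<Longrightarrow> Tr (x - y) = Tr x - Tr y"
  using Tr_add[of x "-y"] Tr_scale[of y "-1"] vn_scale[OF vn_basic_construction, of y "-1"]
  by (simp add: uminus_eq_scale_op[symmetric])

lemma Tr_zero: "Tr 0 = 0"
  using Tr_diff[of e e] by simp

lemma Tr_sum: "(\<And>i. i \<in> I \<Longrightarrow> f i \<in> B\<^sub>1) \<Longrightarrow> Tr (\<Sum>i\<in>I. f i) = (\<Sum>i\<in>I. Tr (f i))"
  by (induction I rule: infinite_finite_induct) (auto simp: Tr_zero Tr_add basic_closed)

text \<open>Cyclicity brings \<open>L (lam i)\<close> to the front of each summand, leaving a left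
  multiplication followed by \<open>e\<close>, to which the Markov property applies.\<close>

lemma Tr_frame_op:
  assumes x: "x \<in> B" and lam: "\<And>i. i \<in> I \<Longrightarrow> lam i \<in> B"
  shows "Tr (L x o\<^sub>L frame_op I lam) = of_real \<tau> * (\<Sum>i\<in>I. tr (lam i o\<^sub>L x o\<^sub>L adj (lam i)))"
proof -
  have "Tr (L x o\<^sub>L (L (adj (lam i)) o\<^sub>L e o\<^sub>L L (lam i))) = of_real \<tau> * tr (lam i o\<^sub>L x o\<^sub>L adj (lam i))"
    if i: "i \<in> I" for i
  proof -
    have "Tr (L x o\<^sub>L (L (adj (lam i)) o\<^sub>L e o\<^sub>L L (lam i))) = Tr ((L x o\<^sub>L L (adj (lam i)) o\<^sub>L e) o\<^sub>L L (lam i))"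
      by (simp add: compose_assoc)
    also have "\<dots> = Tr (L (lam i) o\<^sub>L (L x o\<^sub>L L (adj (lam i)) o\<^sub>L e))"
      using lam[OF i] x by (intro Tr_commute) (auto simp: basic_closed)
    also have "\<dots> = Tr (L (lam i o\<^sub>L x o\<^sub>L adj (lam i)) o\<^sub>L e)"
      using lam[OF i] x by (simp add: lmult_compose compose_assoc[symmetric])
    finally show ?thesis using lam[OF i] x by (simp add: Tr_lmult_jones)
  qed
  then show ?thesis
    using x lam by (simp add: frame_op_def compose_sum_right Tr_sum basic_closed sum_distrib_left)
qed

text \<open>For every \<open>x\<close> in \<open>B\<close>, \<open>Tr (L x)\<close> is
  \<open>tr x\<close>; inserting the frame identity it is also \<open>tr (x o\<^sub>L s)\<close>.
  Faithfulness of \<open>tr\<close> then forces \<open>s\<close> to be the identity.\<close>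

lemma basis_sum_adj_compose:
  assumes lam: "\<And>i. i \<in> I \<Longrightarrow> lam i \<in> B" and frame: "frame_op I lam = id_blinfun"
  shows "scale_op (of_real \<tau>) (\<Sum>i\<in>I. adj (lam i) o\<^sub>L lam i) = id_blinfun"
proof -
  define s where "s = scale_op (of_real \<tau>) (\<Sum>i\<in>I. adj (lam i) o\<^sub>L lam i)"
  have sB: "s \<in> B" unfolding s_def using lam by (simp add: B_sum)
  have "tr (x o\<^sub>L s) = tr x" if x: "x \<in> B" for x
  proof -
    have "tr (x o\<^sub>L s) = of_real \<tau> * (\<Sum>i\<in>I. tr ((x o\<^sub>L adj (lam i)) o\<^sub>L lam i))"
      using x lam by (simp add: s_def compose_scale_op_right compose_sum_right tr_scale tr_sum B_sum compose_assoc)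
    also have "\<dots> = of_real \<tau> * (\<Sum>i\<in>I. tr (lam i o\<^sub>L x o\<^sub>L adj (lam i)))"
      using x lam by (auto intro!: sum.cong arg_cong[where f = "(*) (of_real \<tau>)"] simp: tr_commute[of "x o\<^sub>L adj _"] compose_assoc[of _ x])
    also have "\<dots> = tr x"
      using Tr_frame_op[of x I lam] x lam by (simp add: frame Tr_lmult)
    finally show ?thesis .
  qed
  then have "tr (adj (s - id_blinfun) o\<^sub>L (s - id_blinfun)) = 0"
    using sB by (simp add: compose_diff_right tr_diff)
  then show ?thesis using tr_faithful[of "s - id_blinfun"] sB by (simp add: s_def)
qed

text \<open>Since \<open>Q\<close> is idempotent and self-adjoint, the defect \<open>w\<close> is
  orthogonal to every \<open>adj (lam i) o\<^sub>L a\<close> with \<open>a\<close> in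
  \<open>A\<close>. As \<open>w\<close> is itself a sum of such terms,
  \<open>tr (adj w o\<^sub>L w) = 0\<close>.\<close>

lemma matrix_condition_reproduces:
  assumes lam: "\<And>i. i \<in> I \<Longrightarrow> lam i \<in> B" and Q: "basis_matrix_condition tr \<tau> E I lam" and j: "j \<in> I"
  shows "(\<Sum>i\<in>I. adj (lam i) o\<^sub>L E (lam i o\<^sub>L adj (lam j))) = adj (lam j)"
proof -
  define Q where "Q i j = E (lam i o\<^sub>L adj (lam j))" for i j
  have QA: "Q i j \<in> A" if "i \<in> I" "j \<in> I" for i j using that lam by (simp add: Q_def)
  have Q2: "(\<Sum>k\<in>I. Q i k o\<^sub>L Q k j) = Q i j" and Qadj: "adj (Q j i) = Q i j" if "i \<in> I" "j \<in> I" for i j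
    using Q that by (auto simp: basis_matrix_condition_def Let_def Q_def)
  define w where "w = (\<Sum>i\<in>I. adj (lam i) o\<^sub>L Q i j) - adj (lam j)"
  have wB: "w \<in> B" unfolding w_def using lam j QA by (simp add: B_sum)
  have adj_w: "adj w = (\<Sum>k\<in>I. Q j k o\<^sub>L lam k) - lam j"
    unfolding w_def using lam j QA
    by (subst adj_diff) (auto intro!: bounded_operators_sum sum.cong simp: adj_sum adj_compose Qadj)
  have E_w: "E (adj w o\<^sub>L adj (lam i)) = 0" if i: "i \<in> I" for i
  proof -
    have "E (adj w o\<^sub>L adj (lam i)) = (\<Sum>k\<in>I. E (Q j k o\<^sub>L (lam k o\<^sub>L adj (lam i)))) - Q j i"
      using lam i j QA unfolding adj_w
      by (simp add: compose_diff_left compose_sum_left E_diff E_sum B_sum Q_def compose_assoc)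
    also have "\<dots> = (\<Sum>k\<in>I. Q j k o\<^sub>L Q k i) - Q j i"
      using lam i j QA by (auto intro!: sum.cong simp: E_left Q_def)
    finally show ?thesis using Q2[OF j i] by simp
  qed
  have "tr (adj w o\<^sub>L adj (lam i) o\<^sub>L Q i j) = 0" if i: "i \<in> I" for i
    using tr_E[of "adj w o\<^sub>L adj (lam i) o\<^sub>L Q i j"] lam i j QA wB by (simp add: E_right E_w tr_zero)
  moreover have "tr (adj w o\<^sub>L adj (lam j)) = 0"
    using tr_E[of "adj w o\<^sub>L adj (lam j)"] lam j wB by (simp add: E_w tr_zero)
  ultimately have "tr (adj w o\<^sub>L w) = 0"
    using lam j QA wB
    by (subst (2) w_def) (simp add: compose_diff_right compose_sum_right tr_diff tr_sum B_sum compose_assoc)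
  then have "w = 0" using tr_faithful wB by blast
  then show ?thesis by (simp add: w_def Q_def)
qed

text \<open>The trace on the basic construction is not assumed to be faithful, so that the vanishing of
  \<open>Tr (1 - p)\<close>, for \<open>p\<close> the frame operator, does not yield \<open>p = 1\<close> at once. It does yield
  \<open>Tr ((1 - p) x e x\<^sup>* (1 - p)) = 0\<close> for \<open>x \<in> B\<close>, and the left side is \<open>\<tau> \<parallel>(1 - p) \<eta> x\<parallel>\<^sup>2\<close>.\<close>

lemma matrix_condition_imp_frame:
  assumes I: "finite I" "I \<noteq> {}" and lam: "\<And>i. i \<in> I \<Longrightarrow> lam i \<in> B"
    and Q: "basis_matrix_condition tr \<tau> E I lam"
  shows "frame_op I lam = id_blinfun"
proof -
  define p where "p = frame_op I lam"
  define q where "q = id_blinfun - p"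
  have pB: "p \<in> B\<^sub>1" unfolding p_def frame_op_def using lam by (intro basic_closed) auto
  have qB: "q \<in> B\<^sub>1" unfolding q_def using pB by (intro basic_closed)
  have qb: "q \<in> bounded_operators" and pb: "p \<in> bounded_operators"
    using pB qB vn_bounded[OF vn_basic_construction] by auto
  have "adj p = p"
    unfolding p_def frame_op_def using lam
    by (subst adj_sum) (auto intro!: sum.cong simp: adj_compose adj_lmult adj_jones compose_assoc bounded_operators_compose)
  then have adj_q: "adj q = q" using pb by (simp add: q_def adj_diff)
  have p_eta: "blinfun_apply p (\<eta> x) = \<eta> (\<Sum>i\<in>I. adj (lam i) o\<^sub>L E (lam i o\<^sub>L x))" if "x \<in> B" for x
    unfolding p_def using lam that by (intro frame_op_eta)
  have p_lam: "blinfun_apply p (\<eta> (adj (lam j) o\<^sub>L a)) = \<eta> (adj (lam j) o\<^sub>L a)" if j: "j \<in> I" and a: "a \<in> A" for j a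
  proof -
    have "(\<Sum>i\<in>I. adj (lam i) o\<^sub>L E (lam i o\<^sub>L (adj (lam j) o\<^sub>L a))) =
        (\<Sum>i\<in>I. adj (lam i) o\<^sub>L E (lam i o\<^sub>L adj (lam j))) o\<^sub>L a"
      using lam j a E_right[OF a, of "lam _ o\<^sub>L adj (lam j)"]
      by (auto intro!: sum.cong simp: compose_sum_left compose_assoc)
    also have "\<dots> = adj (lam j) o\<^sub>L a"
      using matrix_condition_reproduces[of I lam j] lam Q j by simp
    finally show ?thesis using lam j a by (simp add: p_eta)
  qed
  have "p o\<^sub>L p = p"
  proof (rule operator_eqI)
    fix x assume x: "x \<in> B"
    have "blinfun_apply p (\<eta> x) = (\<Sum>i\<in>I. \<eta> (adj (lam i) o\<^sub>L E (lam i o\<^sub>L x)))"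
      using lam x by (simp add: p_eta eta_sum)
    then show "blinfun_apply (p o\<^sub>L p) (\<eta> x) = blinfun_apply p (\<eta> x)"
      using lam x by (simp add: blinfun.sum_right p_lam)
  qed
  then have qq: "q o\<^sub>L q = q"
    by (simp add: q_def compose_diff_left compose_diff_right)
  have "Tr p = of_real \<tau> * (\<Sum>i\<in>I. tr (lam i o\<^sub>L adj (lam i)))"
    using Tr_frame_op[of id_blinfun I lam] lam by (simp add: p_def lmult_id)
  also have "(\<Sum>i\<in>I. tr (lam i o\<^sub>L adj (lam i))) = of_real (inverse \<tau>)"
  proof -
    \<comment> \<open>Both sides of the matrix condition are divided by \<open>card I\<close>, which
      is nonzero here and cancels.\<close>
    have "(\<Sum>i\<in>I. tr (E (lam i o\<^sub>L adj (lam i)))) = of_real (inverse \<tau>)"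
      using Q I by (auto simp: basis_matrix_condition_def Let_def card_eq_0_iff)
    then show ?thesis using lam by (simp add: tr_E)
  qed
  also have "of_real \<tau> * (of_real (inverse \<tau>) :: complex) = 1"
    using tau_pos by (simp add: of_real_inverse)
  finally have Tr_q: "Tr q = 0"
    using pB Tr_lmult[of id_blinfun] by (simp add: q_def Tr_diff basic_closed lmult_id tr_id)
  have "blinfun_apply q (\<eta> x) = 0" if x: "x \<in> B" for x
  proof -
    \<comment> \<open>With this choice \<open>adj T o\<^sub>L T\<close> is \<open>x e x*\<close>, so
      that \<open>R\<close> below is the operator \<open>(1 - p) x e x* (1 - p)\<close>.\<close>
    define T where "T = e o\<^sub>L L (adj x)"
    have TB: "T \<in> B\<^sub>1" unfolding T_def using x by (simp add: basic_closed)
    have Tb: "T \<in> bounded_operators" using TB vn_bounded[OF vn_basic_construction] by auto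
    have adj_T: "adj T = L x o\<^sub>L e" using x by (simp add: T_def adj_compose adj_lmult adj_jones)
    let ?c = "complex_of_real ((norm T)\<^sup>2)"
    define R where "R = q o\<^sub>L adj T o\<^sub>L (T o\<^sub>L q)"
    have RB: "R \<in> B\<^sub>1" unfolding R_def using qB TB by (intro basic_closed)
    have "op_nonneg R"
      using op_nonneg_adj_compose[of "T o\<^sub>L q"] qb Tb
      by (simp add: R_def adj_compose adj_q bounded_operators_compose)
    then have 1: "Tr R \<in> \<real>\<^sub>\<ge>\<^sub>0" using RB by (rule Tr_nonneg[rotated])
    \<comment> \<open>This is the inequality \<open>R \<le> (norm T)\<^sup>2 q\<close>; as
      \<open>Tr q = 0\<close>, the trace of \<open>R\<close> is squeezed to zero.\<close>
    have "op_nonneg (adj q o\<^sub>L (scale_op ?c id_blinfun - (adj T o\<^sub>L T)) o\<^sub>L q)"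
      using Tb qb by (intro op_nonneg_conjugate op_nonneg_norm_bound)
    moreover have "adj q o\<^sub>L (scale_op ?c id_blinfun - (adj T o\<^sub>L T)) o\<^sub>L q = scale_op ?c q - R"
      using qb qq by (simp add: adj_q R_def compose_diff_left compose_diff_right compose_scale_op_right
          compose_scale_op_left compose_assoc del: of_real_power)
    ultimately have "op_nonneg (scale_op ?c q - R)" by simp
    then have "Tr (scale_op ?c q - R) \<in> \<real>\<^sub>\<ge>\<^sub>0"
      using qB RB by (intro Tr_nonneg basic_closed)
    then have "- Tr R \<in> \<real>\<^sub>\<ge>\<^sub>0" using qB RB Tr_q by (simp add: Tr_diff Tr_scale basic_closed)
    with 1 have "Tr R = 0" by (auto simp: complex_nonneg_Reals_iff complex_eq_iff)
    define y where "y = adj x o\<^sub>L (x - (\<Sum>i\<in>I. adj (lam i) o\<^sub>L E (lam i o\<^sub>L x)))"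
    have sB: "(\<Sum>i\<in>I. adj (lam i) o\<^sub>L E (lam i o\<^sub>L x)) \<in> B" using lam x by (intro B_sum) simp
    have yB: "y \<in> B" unfolding y_def using x sB by simp
    have "Tr R = Tr ((T o\<^sub>L q) o\<^sub>L (q o\<^sub>L adj T))"
      unfolding R_def using qB TB by (intro Tr_commute basic_closed)
    also have "(T o\<^sub>L q) o\<^sub>L (q o\<^sub>L adj T) = e o\<^sub>L (L (adj x) o\<^sub>L q o\<^sub>L L x o\<^sub>L e)"
      by (simp add: adj_T compose_assoc) (simp add: compose_assoc[of q q, symmetric] qq T_def compose_assoc)
    also have "Tr \<dots> = Tr ((L (adj x) o\<^sub>L q o\<^sub>L L x o\<^sub>L e) o\<^sub>L e)"
      using qB x by (intro Tr_commute basic_closed) auto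
    \<comment> \<open>Right \<open>A\<close>-linearity of \<open>q\<close> turns multiplication by
      \<open>x\<close> followed by \<open>q\<close>, on the range of \<open>e\<close>, into left
      multiplication by one element of \<open>B\<close>.\<close>
    also have "(L (adj x) o\<^sub>L q o\<^sub>L L x o\<^sub>L e) o\<^sub>L e = L y o\<^sub>L e"
    proof (rule operator_eqI)
      fix z assume z: "z \<in> B"
      have "(\<Sum>i\<in>I. adj (lam i) o\<^sub>L E (lam i o\<^sub>L (x o\<^sub>L E z))) = (\<Sum>i\<in>I. adj (lam i) o\<^sub>L E (lam i o\<^sub>L x)) o\<^sub>L E z"
        using lam x z E_right[of "E z" "lam _ o\<^sub>L x"] by (auto intro!: sum.cong simp: compose_sum_left compose_assoc)
      then show "blinfun_apply ((L (adj x) o\<^sub>L q o\<^sub>L L x o\<^sub>L e) o\<^sub>L e) (\<eta> z) = blinfun_apply (L y o\<^sub>L e) (\<eta> z)"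
        using x z yB sB by (simp add: jones_eta E_fix lmult_eta q_def blinfun.diff_left p_eta
            eta_diff[symmetric] y_def compose_assoc compose_diff_left)
    qed
    also have "Tr (L y o\<^sub>L e) = of_real \<tau> * tr y" using yB by (rule Tr_lmult_jones)
    finally have "tr y = 0" using \<open>Tr R = 0\<close> tau_pos by simp
    moreover have "tr y = cinner (blinfun_apply q (\<eta> x)) (\<eta> x)"
      using x sB by (simp add: q_def blinfun.diff_left p_eta eta_diff[symmetric] cinner_eta y_def)
    moreover have "\<dots> = cinner (blinfun_apply q (\<eta> x)) (blinfun_apply q (\<eta> x))"
    proof -
      have "blinfun_apply q (\<eta> x) = blinfun_apply q (blinfun_apply q (\<eta> x))"
        using arg_cong[OF qq, of "\<lambda>S. blinfun_apply S (\<eta> x)"] by simp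
      then show ?thesis using cinner_adj[OF qb, of "blinfun_apply q (\<eta> x)" "\<eta> x"] by (simp add: adj_q)
    qed
    ultimately show ?thesis by (simp add: cinner_self)
  qed
  then have "q = 0" by (intro operator_eqI) simp
  then show ?thesis by (simp add: q_def p_def)
qed

end

section \<open>Bases in towers\<close>

text \<open>Brings the three alternatives in \<open>is_basis\<close> to one form, an expansion
  together with a normalisation. Both pass to products, and neither mentions the basic
  construction.\<close>

lemma is_basis_obtains:
  fixes A B :: "'h::complex_hilbert oper set" and \<eta> :: "'h oper \<Rightarrow> 'k::complex_hilbert"
  assumes vn: "von_neumann_algebra A" "von_neumann_algebra B" "A \<subseteq> B" and L2: "L2_space B tr \<eta>"
    and basis: "is_basis A B tr \<eta> I lam"
  obtains \<tau> E where "\<tau> > 0" "conditional_expectation A B tr E" "basis_expansion_condition B E I lam"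
    "scale_op (of_real \<tau>) (\<Sum>i\<in>I. adj (lam i) o\<^sub>L lam i) = id_blinfun"
proof -
  from basis obtain \<tau> E where \<tau>: "markov_trace A B tr \<eta> \<tau>" and E: "conditional_expectation A B tr E"
    and conds: "basis_matrix_condition tr \<tau> E I lam \<or> basis_projection_condition A B \<eta> I lam \<or>
      basis_expansion_condition B E I lam"
    and I: "finite I" "I \<noteq> {}" and lam: "\<And>i. i \<in> I \<Longrightarrow> lam i \<in> B"
    by (auto simp: is_basis_def)
  \<comment> \<open>That \<open>tr\<close> is a faithful normal tracial state on \<open>B\<close> is
    read off from \<open>markov_trace\<close>; for the lower inclusion of a tower this covers the
    middle algebra.\<close>
  from \<tau> obtain Tr where "tracial_state B tr" "\<tau> > 0" "positive_trace (basic_construction A B \<eta>) Tr"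
    "\<forall>x\<in>B. Tr (lmult B \<eta> x) = tr x"
    "\<forall>x\<in>B. Tr (lmult B \<eta> x o\<^sub>L jones_projection A \<eta>) = of_real \<tau> * tr x"
    by (auto simp: markov_trace_def)
  with vn L2 E interpret markov B tr \<eta> A E \<tau> Tr
    by unfold_locales auto
  have frame: "frame_op I lam = id_blinfun"
    using conds matrix_condition_imp_frame[of I lam] basis_projection_condition_iff_expansion[of I lam] I lam
    by (auto simp: basis_projection_condition_iff_frame_op)
  show ?thesis
    using that[OF tau_pos E] frame lam basis_sum_adj_compose[of I lam]
      basis_projection_condition_iff_expansion[of I lam]
    by (auto simp: basis_projection_condition_iff_frame_op)
qed

lemma conditional_expectation_compose:
  assumes F: "conditional_expectation N M tr F" and G: "conditional_expectation M P tr G" and "N \<subseteq> M"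
  shows "conditional_expectation N P tr (F \<circ> G)"
  using assms unfolding conditional_expectation_def by (simp add: subset_iff)

lemma basis_expansion_condition_tower:
  assumes M: "von_neumann_algebra M" and P: "von_neumann_algebra P" and MP: "M \<subseteq> P"
    and lam: "\<And>i. i \<in> I \<Longrightarrow> lam i \<in> M" and mu: "\<And>j. j \<in> K \<Longrightarrow> mu j \<in> P"
    and G: "conditional_expectation M P tr G"
    and lam_basis: "basis_expansion_condition M F I lam" and mu_basis: "basis_expansion_condition P G K mu"
  shows "basis_expansion_condition P (F \<circ> G) (I \<times> K) (\<lambda>(i, j). lam i o\<^sub>L mu j)"
  unfolding basis_expansion_condition_def
proof
  fix x assume x: "x \<in> P"
  have G_right: "G (y o\<^sub>L b) = G y o\<^sub>L b" if "y \<in> P" "b \<in> M" for y b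
    using G that vn_id[OF M] unfolding conditional_expectation_def
    by (metis id_blinfun_compose(1))
  have GM: "G y \<in> M" if "y \<in> P" for y using G that by (simp add: conditional_expectation_def)
  have step: "G (x o\<^sub>L adj (mu j)) = (\<Sum>i\<in>I. F (G (x o\<^sub>L adj (lam i o\<^sub>L mu j))) o\<^sub>L lam i)" if j: "j \<in> K" for j
  proof -
    let ?y = "G (x o\<^sub>L adj (mu j))"
    have xm: "x o\<^sub>L adj (mu j) \<in> P" using x mu[OF j] vn_adj[OF P] vn_compose[OF P] by blast
    have "?y = (\<Sum>i\<in>I. F (?y o\<^sub>L adj (lam i)) o\<^sub>L lam i)"
      using lam_basis GM[OF xm] by (simp add: basis_expansion_condition_def)
    also have "\<dots> = (\<Sum>i\<in>I. F (G (x o\<^sub>L adj (lam i o\<^sub>L mu j))) o\<^sub>L lam i)"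
    proof (intro sum.cong refl)
      fix i assume i: "i \<in> I"
      \<comment> \<open>Right \<open>M\<close>-linearity of \<open>G\<close> absorbs
        \<open>adj (lam i)\<close>, which produces the adjoint of the product
        \<open>lam i o\<^sub>L mu j\<close>.\<close>
      have "?y o\<^sub>L adj (lam i) = G (x o\<^sub>L adj (mu j) o\<^sub>L adj (lam i))"
        using G_right[OF xm vn_adj[OF M lam[OF i]]] by simp
      then show "F (?y o\<^sub>L adj (lam i)) o\<^sub>L lam i = F (G (x o\<^sub>L adj (lam i o\<^sub>L mu j))) o\<^sub>L lam i"
        using vn_bounded[OF M lam[OF i]] vn_bounded[OF P mu[OF j]] by (simp add: adj_compose compose_assoc)
    qed
    finally show ?thesis .
  qed
  have "x = (\<Sum>j\<in>K. G (x o\<^sub>L adj (mu j)) o\<^sub>L mu j)"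
    using mu_basis x by (simp add: basis_expansion_condition_def)
  also have "\<dots> = (\<Sum>j\<in>K. \<Sum>i\<in>I. F (G (x o\<^sub>L adj (lam i o\<^sub>L mu j))) o\<^sub>L (lam i o\<^sub>L mu j))"
  proof (intro sum.cong refl)
    fix j assume j: "j \<in> K"
    show "G (x o\<^sub>L adj (mu j)) o\<^sub>L mu j = (\<Sum>i\<in>I. F (G (x o\<^sub>L adj (lam i o\<^sub>L mu j))) o\<^sub>L (lam i o\<^sub>L mu j))"
      by (subst step[OF j]) (simp add: compose_sum_left compose_assoc)
  qed
  also have "\<dots> = (\<Sum>i\<in>I. \<Sum>j\<in>K. F (G (x o\<^sub>L adj (lam i o\<^sub>L mu j))) o\<^sub>L (lam i o\<^sub>L mu j))"
    by (rule sum.swap)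
  also have "\<dots> = (\<Sum>k\<in>I \<times> K. (F \<circ> G) (x o\<^sub>L adj ((\<lambda>(i, j). lam i o\<^sub>L mu j) k)) o\<^sub>L (\<lambda>(i, j). lam i o\<^sub>L mu j) k)"
    by (simp add: sum.cartesian_product case_prod_unfold)
  finally show "x = (\<Sum>k\<in>I \<times> K. (F \<circ> G) (x o\<^sub>L adj ((\<lambda>(i, j). lam i o\<^sub>L mu j) k)) o\<^sub>L (\<lambda>(i, j). lam i o\<^sub>L mu j) k)" .
qed

text \<open>Summing over \<open>i\<close> first leaves a multiple of the identity between
  \<open>adj (mu j)\<close> and \<open>mu j\<close>, which can be pulled out of the sum over
  \<open>j\<close>.\<close>

lemma sum_adj_compose_tower:
  assumes lam: "\<And>i. i \<in> I \<Longrightarrow> lam i \<in> bounded_operators" and mu: "\<And>j. j \<in> K \<Longrightarrow> mu j \<in> bounded_operators"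
    and lam_sum: "scale_op c (\<Sum>i\<in>I. adj (lam i) o\<^sub>L lam i) = id_blinfun"
    and mu_sum: "scale_op d (\<Sum>j\<in>K. adj (mu j) o\<^sub>L mu j) = id_blinfun"
  shows "scale_op (c * d) (\<Sum>k\<in>I \<times> K. adj ((\<lambda>(i, j). lam i o\<^sub>L mu j) k) o\<^sub>L (\<lambda>(i, j). lam i o\<^sub>L mu j) k) = id_blinfun"
proof -
  have "(\<Sum>k\<in>I \<times> K. adj ((\<lambda>(i, j). lam i o\<^sub>L mu j) k) o\<^sub>L (\<lambda>(i, j). lam i o\<^sub>L mu j) k) =
      (\<Sum>i\<in>I. \<Sum>j\<in>K. adj (lam i o\<^sub>L mu j) o\<^sub>L (lam i o\<^sub>L mu j))"
    by (simp add: sum.cartesian_product case_prod_unfold)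
  also have "\<dots> = (\<Sum>j\<in>K. \<Sum>i\<in>I. adj (lam i o\<^sub>L mu j) o\<^sub>L (lam i o\<^sub>L mu j))"
    by (rule sum.swap)
  also have "\<dots> = (\<Sum>j\<in>K. adj (mu j) o\<^sub>L (\<Sum>i\<in>I. adj (lam i) o\<^sub>L lam i) o\<^sub>L mu j)"
    using lam mu by (intro sum.cong refl) (simp add: adj_compose compose_assoc compose_sum_left compose_sum_right)
  finally have "scale_op (c * d) (\<Sum>k\<in>I \<times> K. adj ((\<lambda>(i, j). lam i o\<^sub>L mu j) k) o\<^sub>L (\<lambda>(i, j). lam i o\<^sub>L mu j) k) =
      scale_op d (scale_op c (\<Sum>j\<in>K. adj (mu j) o\<^sub>L (\<Sum>i\<in>I. adj (lam i) o\<^sub>L lam i) o\<^sub>L mu j))"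
    by (simp add: mult.commute)
  also have "scale_op c (\<Sum>j\<in>K. adj (mu j) o\<^sub>L (\<Sum>i\<in>I. adj (lam i) o\<^sub>L lam i) o\<^sub>L mu j) =
      (\<Sum>j\<in>K. adj (mu j) o\<^sub>L scale_op c (\<Sum>i\<in>I. adj (lam i) o\<^sub>L lam i) o\<^sub>L mu j)"
    using mu by (simp add: scale_op_sum[where I = K] compose_scale_op_left compose_scale_op_right adj_bounded)
  finally show ?thesis by (simp add: lam_sum mu_sum)
qed

theorem corollary2p7:
  fixes N M P :: "'h::complex_hilbert oper set"
    and tr :: "'h oper \<Rightarrow> complex"
    and \<eta>\<^sub>M :: "'h oper \<Rightarrow> 'k1::complex_hilbert"
    and \<eta>\<^sub>P :: "'h oper \<Rightarrow> 'k2::complex_hilbert"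
    and lam mu :: "nat \<Rightarrow> 'h oper"
    and m n :: nat
  assumes "von_neumann_algebra N" and "von_neumann_algebra M" and "von_neumann_algebra P"
    and "N \<subseteq> M" and "M \<subseteq> P"
    and "tracial_state P tr"
    and "L2_space M tr \<eta>\<^sub>M" and "L2_space P tr \<eta>\<^sub>P"
    and "(II1_factor N \<and> II1_factor M \<and> II1_factor P \<and> jones_index N P \<eta>\<^sub>P < \<infinity>) \<or>
         (finite_dimensional N \<and> finite_dimensional M \<and> finite_dimensional P \<and>
          connected_inclusion N M \<and> connected_inclusion M P)"
    and "is_basis N M tr \<eta>\<^sub>M {1..m} lam"
    and "is_basis M P tr \<eta>\<^sub>P {1..n} mu"
  shows "is_basis N P tr \<eta>\<^sub>P ({1..m} \<times> {1..n}) (\<lambda>(i, j). lam i o\<^sub>L mu j)"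
proof -
  let ?nu = "\<lambda>(i, j). lam i o\<^sub>L mu j"
  obtain \<sigma> F where F: "\<sigma> > 0" "conditional_expectation N M tr F" "basis_expansion_condition M F {1..m} lam"
    "scale_op (of_real \<sigma>) (\<Sum>i\<in>{1..m}. adj (lam i) o\<^sub>L lam i) = id_blinfun"
    using is_basis_obtains[OF assms(1,2,4,7,10)] by blast
  obtain \<rho> G where G: "\<rho> > 0" "conditional_expectation M P tr G" "basis_expansion_condition P G {1..n} mu"
    "scale_op (of_real \<rho>) (\<Sum>j\<in>{1..n}. adj (mu j) o\<^sub>L mu j) = id_blinfun"
    using is_basis_obtains[OF assms(2,3,5,8,11)] by blast
  have lam: "lam i \<in> M" if "i \<in> {1..m}" for i using assms(10) that by (simp add: is_basis_def)
  have mu: "mu j \<in> P" if "j \<in> {1..n}" for j using assms(11) that by (simp add: is_basis_def)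
  have E: "conditional_expectation N P tr (F \<circ> G)"
    using F(2) G(2) assms(4) by (rule conditional_expectation_compose)
  interpret expectation P tr \<eta>\<^sub>P N "F \<circ> G"
    by unfold_locales (use assms E in auto)
  have nu: "?nu k \<in> P" if "k \<in> {1..m} \<times> {1..n}" for k
    using that subsetD[OF assms(5) lam] mu by (auto intro!: vn_compose[OF assms(3)])
  have expansion: "basis_expansion_condition P (F \<circ> G) ({1..m} \<times> {1..n}) ?nu"
    by (rule basis_expansion_condition_tower[OF assms(2,3,5) lam mu G(2) F(3) G(3)])
  have "scale_op (of_real \<sigma> * of_real \<rho>) (\<Sum>k\<in>{1..m} \<times> {1..n}. adj (?nu k) o\<^sub>L ?nu k) = id_blinfun"
    using F(4) G(4) vn_bounded[OF assms(2) lam] vn_bounded[OF assms(3) mu]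
    by (intro sum_adj_compose_tower) auto
  then have "markov_trace N P tr \<eta>\<^sub>P (\<sigma> * \<rho>)"
    using F(1) G(1) by (intro markov_trace_of_basis[OF nu expansion]) simp_all
  moreover have "{1..m} \<times> {1..n} \<noteq> {}"
    using assms(10,11) by (simp add: is_basis_def)
  \<comment> \<open>The witnesses in \<open>is_basis\<close> are the modulus
    \<open>\<sigma> * \<rho>\<close> and the expectation \<open>F \<circ> G\<close>, and the
    expansion is the alternative that is verified.\<close>
  ultimately show ?thesis
    unfolding is_basis_def using E expansion nu by blast
qed

end
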